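(* Let $w\in\mathcal S_n$. Then $$\mathcal G_w(x;y)=\sum_{\gamma}(-1)^{\ell(\gamma)-m(\gamma)}\,\frac{\mathcal G_{\omega_0}(x;y)}{\mu_{x,y}(\gamma)},$$ the sum over all climbing marked chains $\gamma$ from $w$ to $\omega_0$ in the Bruhat order on $\mathcal S_n$. (Setting all $y_j=0$ recovers the formula $\mathcal G_w=\sum_\gamma(-1)^{\ell(\gamma)-m(\gamma)}x^{\delta}/x^{\alpha(\gamma)}$ for the ordinary Grothendieck polynomial, where $\delta=(n-1,\dots,1)$ and $\alpha(\gamma)_k$ is the number of marked covers of $\gamma$ in its segment in the $k$-Bruhat order.)
   Context: Permutations are written in one-line notation, products are compositions $(uv)(i)=u(v(i))$, $s_i$ is the transposition of $i,i+1$, $t_{a,b}$ ($a<b$) the transposition of $a,b$, $\ell(w)$ the number of inversions, $\omega_0=[n,n-1,\dots,1]$. Double Grothendieck polynomials: $s_i$ acts on polynomials in $x_1,\dots,x_n,y_1,\dots,y_n$ by exchanging $x_i,x_{i+1}$. Let $\pi_i f=\dfrac{(1-x_{i+1})f-s_i((1-x_{i+1})f)}{x_i-x_{i+1}}$ and $\pi_v=\pi_{i_1}\cdots\pi_{i_r}$ for any reduced word $v=s_{i_1}\cdots s_{i_r}$. Then $\mathcal G_{\omega_0}(x;y)=\prod_{i+j\le n}(x_i+y_j-x_iy_j)$ and $\mathcal G_w(x;y)=\pi_{w^{-1}\omega_0}\mathcal G_{\omega_0}(x;y)$. The ordinary Grothendieck polynomial is $\mathcal G_w=\mathcal G_w(x;0)$.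 Chains: for $1\le k<n$, a cover in the $k$-Bruhat order on $\mathcal S_n$ is $u\xrightarrow{(a,b)}u\,t_{a,b}$ with $a\le k<b$ and $\ell(u\,t_{a,b})=\ell(u)+1$. A chain is a (possibly empty) sequence of successive covers; with labels $(a_1,b_1),\dots,(a_j,b_j)$ it is increasing if for all $1\le i<j$ either $a_i<a_{i+1}$, or $a_i=a_{i+1}$ and $b_i>b_{i+1}$. A marked chain in the $k$-Bruhat order is a chain together with a set of marked covers that includes the first cover (if there is one), such that cutting the chain at the permutation before each marked cover decomposes it into increasing segments. A climbing marked chain from $w$ to $\omega_0$ is a concatenation, in this order, of marked chains in the $1$-, $2$-, $\dots$, $(n-1)$-Bruhat orders (some possibly empty), starting at $w$ and ending at $\omega_0$, such that the permutation at the end of the chain in the $k$-Bruhat order has the form $[n,n-1,\dots,n-k+1,\dots]$. $\ell(\gamma)$ is the number of covers, $m(\gamma)$ the number of marked covers. For a cover $u\lessdot v$ set $t_{i,k}=u^{-1}v$ and $t_{j,l}=vu^{-1}$ with $i<k$ and $j<l$. For a climbing marked chain $\gamma$, $\mu_{x,y}(\gamma)=\prod(x_i+y_j-x_iy_j)$, the product taken over all marked covers in $\gamma$. *)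

theory Defs
  imports
    "HOL-Library.Poly_Mapping"
    "HOL-Computational_Algebra.Fraction_Field"
    "HOL-Combinatorics.Permutations"
begin

section \<open>Polynomials and rational functions in $x_1, x_2, \dots, y_1, y_2, \dots$\<close>

datatype var = X nat | Y nat

text \<open>
  The library's instance of \<^class>\<open>idom\<close> for polynomials, needed to form their fraction field,
  asks for a linear order on the variables; which one is irrelevant.
\<close>

instantiation var :: linorder
begin

fun less_eq_var :: "var \<Rightarrow> var \<Rightarrow> bool" where
  "less_eq_var (X i) (X j) = (i \<le> j)"
| "less_eq_var (X i) (Y j) = True"
| "less_eq_var (Y i) (X j) = False"
| "less_eq_var (Y i) (Y j) = (i \<le> j)"

definition less_var :: "var \<Rightarrow> var \<Rightarrow> bool" where
  "less_var u v \<longleftrightarrow> u \<le> v \<and> \<not> v \<le> u"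

instance
proof
  fix u v w :: var
  show "u < v \<longleftrightarrow> u \<le> v \<and> \<not> v \<le> u" by (rule less_var_def)
  show "u \<le> u" by (cases u) auto
  show "u \<le> v \<Longrightarrow> v \<le> w \<Longrightarrow> u \<le> w" by (cases u; cases v; cases w) auto
  show "u \<le> v \<Longrightarrow> v \<le> u \<Longrightarrow> u = v" by (cases u; cases v) auto
  show "u \<le> v \<or> v \<le> u" by (cases u; cases v) auto
qed

end

type_synonym mpoly = "(var \<Rightarrow>\<^sub>0 nat) \<Rightarrow>\<^sub>0 int"

definition Var :: "var \<Rightarrow> mpoly" where
  "Var v = Poly_Mapping.single (Poly_Mapping.single v 1) 1"

abbreviation xvar :: "nat \<Rightarrow> mpoly" where "xvar i \<equiv> Var (X i)"
abbreviation yvar :: "nat \<Rightarrow> mpoly" where "yvar j \<equiv> Var (Y j)"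

text \<open>Simultaneous substitution of the polynomial \<open>\<sigma> v\<close> for every variable \<open>v\<close>.\<close>

definition subst :: "(var \<Rightarrow> mpoly) \<Rightarrow> mpoly \<Rightarrow> mpoly" where
  "subst \<sigma> f = (\<Sum>m\<in>Poly_Mapping.keys f. of_int (Poly_Mapping.lookup f m) *
     (\<Prod>v\<in>Poly_Mapping.keys m. \<sigma> v ^ Poly_Mapping.lookup m v))"

fun swap_var :: "nat \<Rightarrow> var \<Rightarrow> var" where
  "swap_var i (X k) = X (transpose i (i + 1) k)"
| "swap_var i (Y k) = Y k"

definition s_act :: "nat \<Rightarrow> mpoly \<Rightarrow> mpoly" where
  "s_act i = subst (\<lambda>v. Var (swap_var i v))"

definition set_y_0 :: "mpoly \<Rightarrow> mpoly" where
  "set_y_0 = subst (\<lambda>v. case v of X i \<Rightarrow> xvar i | Y j \<Rightarrow> 0)"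

definition ratfun :: "mpoly \<Rightarrow> mpoly fract" where
  "ratfun f = Fract f 1"


section \<open>Permutations\<close>

text \<open>Elements of $S_n$ are functions \<open>w\<close> with \<open>w permutes {1..n}\<close>.\<close>

definition inversions :: "nat \<Rightarrow> (nat \<Rightarrow> nat) \<Rightarrow> nat" where
  "inversions n w = card {(i, j). 1 \<le> i \<and> i < j \<and> j \<le> n \<and> w j < w i}"

definition longest :: "nat \<Rightarrow> nat \<Rightarrow> nat" where
  "longest n i = (if i \<in> {1..n} then n + 1 - i else i)"

text \<open>\<open>is\<close> is a reduced word of \<open>v\<close>: \<open>v = s\<^bsub>i\<^sub>1\<^esub> \<circ> \<dots> \<circ> s\<^bsub>i\<^sub>r\<^esub>\<close> with \<open>r = \<ell>(v)\<close>.\<close>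

definition reduced_word :: "nat \<Rightarrow> (nat \<Rightarrow> nat) \<Rightarrow> nat list \<Rightarrow> bool" where
  "reduced_word n v is \<longleftrightarrow> set is \<subseteq> {1..<n} \<and>
     foldr (\<lambda>i u. transpose i (i + 1) \<circ> u) is id = v \<and> length is = inversions n v"


section \<open>Double Grothendieck polynomials\<close>

text \<open>
  The defining fraction is an exact quotient of polynomials; existence and uniqueness of the
  quotient are the lemma \<open>pi_op\<close> below.
\<close>

definition pi_op :: "nat \<Rightarrow> mpoly \<Rightarrow> mpoly" where
  "pi_op i f = (THE g. (xvar i - xvar (i + 1)) * g =
     (1 - xvar (i + 1)) * f - s_act i ((1 - xvar (i + 1)) * f))"

text \<open>
  The operators \<open>pi_op i\<close> satisfy the braid relations, so the result does not depend on which
  reduced word is chosen.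
\<close>

definition pi_perm :: "nat \<Rightarrow> (nat \<Rightarrow> nat) \<Rightarrow> mpoly \<Rightarrow> mpoly" where
  "pi_perm n v = foldr pi_op (SOME is. reduced_word n v is)"

definition weight :: "nat \<Rightarrow> nat \<Rightarrow> mpoly" where
  "weight i j = xvar i + yvar j - xvar i * yvar j"

definition Groth_longest :: "nat \<Rightarrow> mpoly" where
  "Groth_longest n = (\<Prod>(i, j) \<in> {(i, j). 1 \<le> i \<and> 1 \<le> j \<and> i + j \<le> n}. weight i j)"

definition double_Groth :: "nat \<Rightarrow> (nat \<Rightarrow> nat) \<Rightarrow> mpoly" where
  "double_Groth n w = pi_perm n (inv w \<circ> longest n) (Groth_longest n)"

definition Groth :: "nat \<Rightarrow> (nat \<Rightarrow> nat) \<Rightarrow> mpoly" where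
  "Groth n w = set_y_0 (double_Groth n w)"


section \<open>Climbing marked chains\<close>

text \<open>
  A chain is given by its starting permutation \<open>u\<close> and its list of labels \<open>(a, b)\<close>. In a marked
  chain every label carries a flag that is \<open>True\<close> iff the cover is marked.
\<close>

type_synonym label = "nat \<times> nat"
type_synonym marked_chain = "(label \<times> bool) list"

fun chain_end :: "(nat \<Rightarrow> nat) \<Rightarrow> label list \<Rightarrow> nat \<Rightarrow> nat" where
  "chain_end u [] = u"
| "chain_end u ((a, b) # c) = chain_end (u \<circ> transpose a b) c"

fun is_chain :: "nat \<Rightarrow> nat \<Rightarrow> (nat \<Rightarrow> nat) \<Rightarrow> label list \<Rightarrow> bool" where
  "is_chain n k u [] = True"
| "is_chain n k u ((a, b) # c) \<longleftrightarrow>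
     1 \<le> a \<and> a \<le> k \<and> k < b \<and> b \<le> n \<and>
     inversions n (u \<circ> transpose a b) = inversions n u + 1 \<and>
     is_chain n k (u \<circ> transpose a b) c"

definition increasing :: "label list \<Rightarrow> bool" where
  "increasing = successively (\<lambda>(a, b) (a', b'). a < a' \<or> a = a' \<and> b > b')"

text \<open>The segments obtained by cutting before each marked cover.\<close>

function segments :: "marked_chain \<Rightarrow> label list list" where
  "segments [] = []"
| "segments (e # c) =
     map fst (e # takeWhile (\<lambda>d. \<not> snd d) c) # segments (dropWhile (\<lambda>d. \<not> snd d) c)"
  by pat_completeness auto
termination
  by (relation "measure length") (auto simp: less_Suc_eq_le length_dropWhile_le)

definition is_marked_chain :: "nat \<Rightarrow> nat \<Rightarrow> (nat \<Rightarrow> nat) \<Rightarrow> marked_chain \<Rightarrow> bool" where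
  "is_marked_chain n k u c \<longleftrightarrow> is_chain n k u (map fst c) \<and>
     (c \<noteq> [] \<longrightarrow> snd (hd c)) \<and> (\<forall>s\<in>set (segments c). increasing s)"

text \<open>
  A climbing marked chain is the list \<open>\<gamma>\<close> of its parts in the \<open>1\<close>-, \<dots>, \<open>(n - 1)\<close>-Bruhat orders;
  the part in the \<open>k\<close>-Bruhat order is \<open>\<gamma> ! (k - 1)\<close>, and it leads from \<open>stage w \<gamma> (k - 1)\<close>
  to \<open>stage w \<gamma> k\<close>.
\<close>

definition stage :: "(nat \<Rightarrow> nat) \<Rightarrow> marked_chain list \<Rightarrow> nat \<Rightarrow> nat \<Rightarrow> nat" where
  "stage w \<gamma> k = chain_end w (map fst (concat (take k \<gamma>)))"

definition climbing_marked_chains :: "nat \<Rightarrow> (nat \<Rightarrow> nat) \<Rightarrow> marked_chain list set" where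
  "climbing_marked_chains n w = {\<gamma>. length \<gamma> = n - 1 \<and>
     (\<forall>k\<in>{1..<n}. is_marked_chain n k (stage w \<gamma> (k - 1)) (\<gamma> ! (k - 1)) \<and>
        (\<forall>i\<in>{1..k}. stage w \<gamma> k i = n + 1 - i)) \<and>
     stage w \<gamma> (n - 1) = longest n}"

definition num_covers :: "marked_chain list \<Rightarrow> nat" where
  "num_covers \<gamma> = length (concat \<gamma>)"

definition num_marked :: "marked_chain list \<Rightarrow> nat" where
  "num_marked \<gamma> = length (filter snd (concat \<gamma>))"

definition marked_in :: "marked_chain list \<Rightarrow> nat \<Rightarrow> nat" where
  "marked_in \<gamma> k = length (filter snd (\<gamma> ! (k - 1)))"

text \<open>The smaller of the two indices exchanged by a transposition.\<close>

definition lower_index :: "(nat \<Rightarrow> nat) \<Rightarrow> nat" where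
  "lower_index t = (THE i. \<exists>k>i. t = transpose i k)"

definition cover_weight :: "(nat \<Rightarrow> nat) \<Rightarrow> (nat \<Rightarrow> nat) \<Rightarrow> mpoly" where
  "cover_weight u v = weight (lower_index (inv u \<circ> v)) (lower_index (v \<circ> inv u))"

definition perm_at :: "(nat \<Rightarrow> nat) \<Rightarrow> marked_chain list \<Rightarrow> nat \<Rightarrow> nat \<Rightarrow> nat" where
  "perm_at w \<gamma> p = chain_end w (map fst (take p (concat \<gamma>)))"

definition mu :: "(nat \<Rightarrow> nat) \<Rightarrow> marked_chain list \<Rightarrow> mpoly" where
  "mu w \<gamma> = (\<Prod>p\<in>{p. p < length (concat \<gamma>) \<and> snd (concat \<gamma> ! p)}.
     cover_weight (perm_at w \<gamma> p) (perm_at w \<gamma> (p + 1)))"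


section \<open>Well-definedness of the quotient\<close>

lemma single_power: "Poly_Mapping.single (Poly_Mapping.single v (Suc 0)) (1::int) ^ k
    = Poly_Mapping.single (Poly_Mapping.single v k) 1"
  for v :: var
proof (induction k)
  case (Suc k)
  then show ?case
    by (simp add: Poly_Mapping.mult_single flip: Poly_Mapping.single_add)
qed simp

lemma prod_single: "(\<Prod>v\<in>A. Poly_Mapping.single (g v) (1::int))
    = Poly_Mapping.single (\<Sum>v\<in>A. g v) 1"
  for g :: "var \<Rightarrow> (var \<Rightarrow>\<^sub>0 nat)"
  by (induction A rule: infinite_finite_induct)
     (simp_all add: Poly_Mapping.mult_single)

lemma sum_singles: "(\<Sum>m\<in>Poly_Mapping.keys f. Poly_Mapping.single m (Poly_Mapping.lookup f m)) = f"
  by (rule poly_mapping_eqI)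
     (simp add: Poly_Mapping.lookup_sum lookup_single when_def sum.delta in_keys_iff)

lemma subst_Var: "subst Var f = f"
proof -
  have "of_int (Poly_Mapping.lookup f m) *
      (\<Prod>v\<in>Poly_Mapping.keys m. Var v ^ Poly_Mapping.lookup m v)
      = Poly_Mapping.single m (Poly_Mapping.lookup f m)" for m
    by (simp add: Var_def single_power prod_single sum_singles mult_single flip: single_of_int)
  then show ?thesis
    by (simp add: subst_def sum_singles)
qed

lemma dvd_diff_mult: "d dvd a - a' \<Longrightarrow> d dvd b - b' \<Longrightarrow> d dvd a * b - a' * b'"
  for a b d :: mpoly
proof -
  assume "d dvd a - a'" "d dvd b - b'"
  then have "d dvd a * (b - b') + (a - a') * b'" by (intro dvd_add dvd_mult dvd_mult2)
  then show ?thesis by (simp add: algebra_simps)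
qed

lemma dvd_diff_power: "d dvd a - a' \<Longrightarrow> d dvd a ^ k - a' ^ k" for a d :: mpoly
  by (induction k) (auto intro: dvd_diff_mult)

lemma dvd_diff_prod: "(\<And>v. d dvd g v - h v) \<Longrightarrow> d dvd prod g A - prod h A"
  for d :: mpoly and g h :: "'a \<Rightarrow> mpoly"
  by (induction A rule: infinite_finite_induct) (auto intro: dvd_diff_mult)

lemma dvd_s_act: "xvar i - xvar (i + 1) dvd f - s_act i f"
proof -
  have v: "xvar i - xvar (i + 1) dvd Var v - Var (swap_var i v)" for v
  proof (cases v)
    case (X k)
    have "xvar i - xvar (i + 1) dvd - (xvar i - xvar (i + 1))" by (simp only: dvd_minus_iff dvd_refl)
    then show ?thesis using X by (auto simp: transpose_def)
  qed simp
  have "f - s_act i f = subst Var f - s_act i f" by (simp add: subst_Var)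
  also have "xvar i - xvar (i + 1) dvd \<dots>"
    unfolding s_act_def subst_def sum_subtractf[symmetric] right_diff_distrib[symmetric]
    by (intro dvd_sum dvd_mult dvd_diff_prod dvd_diff_power v)
  finally show ?thesis .
qed

lemma pi_op: "(xvar i - xvar (i + 1)) * pi_op i f =
    (1 - xvar (i + 1)) * f - s_act i ((1 - xvar (i + 1)) * f)"
proof -
  have "xvar i \<noteq> xvar (i + 1)"
  proof
    assume "xvar i = xvar (i + 1)"
    then have "Poly_Mapping.lookup (xvar i) (Poly_Mapping.single (X i) 1)
      = Poly_Mapping.lookup (xvar (i + 1)) (Poly_Mapping.single (X i) 1)" by simp
    then have "Poly_Mapping.single (X (i + 1)) (1::nat) = Poly_Mapping.single (X i) 1"
      by (simp add: Var_def lookup_single when_def split: if_splits)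
    then have "Poly_Mapping.lookup (Poly_Mapping.single (X (i + 1)) (1::nat)) (X i) = 1"
      by simp
    then show False by (simp add: lookup_single when_def)
  qed
  moreover obtain g where "(1 - xvar (i + 1)) * f - s_act i ((1 - xvar (i + 1)) * f)
      = (xvar i - xvar (i + 1)) * g"
    using dvd_s_act[of i "(1 - xvar (i + 1)) * f"] by (elim dvdE)
  ultimately have "\<exists>!g. (xvar i - xvar (i + 1)) * g =
      (1 - xvar (i + 1)) * f - s_act i ((1 - xvar (i + 1)) * f)"
    by (intro ex1I[of _ g]) auto
  then show ?thesis unfolding pi_op_def by (rule theI')
qed

section \<open>Finiteness of the sum over climbing marked chains\<close>

lemma inversions_le: "inversions n u \<le> n * n"
proof -
  have "inversions n u \<le> card ({1..n} \<times> {1..n})"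
    unfolding inversions_def by (intro card_mono) auto
  then show ?thesis by simp
qed

lemma is_chain_bounds:
  "is_chain n k u c \<Longrightarrow>
     set c \<subseteq> {1..n} \<times> {1..n} \<and> inversions n u + length c = inversions n (chain_end u c)"
  by (induction n k u c rule: is_chain.induct) auto

lemma finite_climbing_marked_chains: "finite (climbing_marked_chains n w)"
proof -
  define L where "L = {c. set c \<subseteq> ({1..n} \<times> {1..n}) \<times> (UNIV :: bool set) \<and> length c \<le> n * n}"
  have "finite L"
    unfolding L_def by (intro finite_lists_length_le) auto
  have part: "c \<in> L" if "is_marked_chain n k u c" for k u c
  proof -
    have *: "set (map fst c) \<subseteq> {1..n} \<times> {1..n}"
      "inversions n u + length c = inversions n (chain_end u (map fst c))"
      using that is_chain_bounds[of n k u "map fst c"] by (auto simp: is_marked_chain_def)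
    have "length c \<le> n * n"
      using *(2) inversions_le[of n "chain_end u (map fst c)"] by linarith
    then show ?thesis using *(1) by (fastforce simp: L_def)
  qed
  have "set \<gamma> \<subseteq> L \<and> length \<gamma> = n - 1" if "\<gamma> \<in> climbing_marked_chains n w" for \<gamma>
  proof -
    have len: "length \<gamma> = n - 1" using that by (simp add: climbing_marked_chains_def)
    have "\<gamma> ! j \<in> L" if "j < length \<gamma>" for j
    proof -
      have "j + 1 \<in> {1..<n}" using that len by auto
      with \<open>\<gamma> \<in> climbing_marked_chains n w\<close>
      have "is_marked_chain n (j + 1) (stage w \<gamma> (j + 1 - 1)) (\<gamma> ! (j + 1 - 1))"
        unfolding climbing_marked_chains_def by blast
      then show ?thesis using part by simp
    qed
    then show ?thesis using len by (auto simp: in_set_conv_nth)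
  qed
  then have "climbing_marked_chains n w \<subseteq> {\<gamma>. set \<gamma> \<subseteq> L \<and> length \<gamma> = n - 1}" by blast
  then show ?thesis
    using finite_lists_length_eq[OF \<open>finite L\<close>] by (rule finite_subset)
qed

end

theory Submission
  imports Defs
begin

text \<open>
  Write \<open>G w\<close> for the double Grothendieck polynomial of \<open>w\<close>. Suppose that \<open>w\<close> carries the values
  \<open>n, n - 1, \<dots>, n - k + 2\<close> at the positions \<open>1, \<dots>, k - 1\<close>. These values cannot be raised by a
  cover, so the part of a climbing chain in the \<open>k\<close>-Bruhat order consists of covers with labels
  \<open>(k, b)\<close> only: it raises the value at position \<open>k\<close> step by step to \<open>n + 1 - k\<close>. A segment is
  increasing if its labels \<open>b\<close> decrease. The formula is therefore an iteration of the transition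
  formula

    \<open>weight p (w p) * G w = \<Sum> (-1)\<^bsup>j-1\<^esup> G (w t\<^bsub>p,b\<^sub>1\<^esub> \<dots> t\<^bsub>p,b\<^sub>j\<^esub>)\<close>,

  the sum over all saturated chains with \<open>j \<ge> 1\<close> and \<open>b\<^sub>1 > \<dots> > b\<^sub>j > p\<close>. Each segment is one use
  of it: the marked cover at its beginning divides by \<open>weight p (w p)\<close>, the other covers give the
  sign (lemma \<open>stage_chains_sum\<close>). Once position \<open>k\<close> is at its maximum the next part takes over,
  and at the longest permutation the product \<open>Groth_longest n\<close> is left (theorem \<open>climbing_sum\<close>).

  The transition formula (theorem \<open>transition\<close>) holds at every left-to-right minimum \<open>p\<close> of \<open>w\<close>.
  Subtracting the right-hand side from \<open>G w\<close>, the term of the empty chain, gives \<open>descending_sum\<close>,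
  an operator that can be applied to any function \<open>R\<close> on permutations. It turns the formula into
  \<open>(1 - weight p (w p)) * G w = descending_sum G p (n + 1) w\<close>, and the proof is by descending
  induction on the length. Let \<open>i\<close> be an ascent of \<open>w\<close>, so \<open>G w = pi_op i (G (w s\<^sub>i))\<close>. If \<open>i\<close> is
  away from \<open>p\<close>, the operator commutes with the 0-Hecke action of \<open>i\<close> (\<open>descending_sum_sort\<close>), and
  the formula for \<open>w s\<^sub>i\<close> at \<open>p\<close> gives the one for \<open>w\<close>. If \<open>i = p\<close>, the sum for \<open>w\<close> at \<open>p\<close> is the
  difference of \<open>pi_op p\<close> and the identity applied to the sum for \<open>w s\<^sub>p\<close> at \<open>p + 1\<close>
  (\<open>descending_sum_shift\<close>), and the formula follows from the twisted Leibniz rule \<open>pi_op_Leibniz\<close>.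

  The induction starts at the longest permutation, where the formula involves a permutation of
  \<open>S\<^bsub>n+1\<^esub>\<close>. Therefore the polynomials are considered in \<open>S\<^bsub>n+1\<^esub>\<close>; that this does not change them,
  and the value on the one new permutation, follow from explicit products for dominant
  permutations. All of this uses \<open>pi_op i (G w) = G (w s\<^sub>i)\<close> for every descent \<open>i\<close>, that is,
  independence of the reduced word; it is derived from the braid relations in \<open>Groth_path_unique\<close>.
\<close>


section \<open>Substitutions are ring homomorphisms\<close>

text \<open>
  The inner product in the definition of \<^const>\<open>subst\<close>. Isolating it reduces multiplicativity of a
  substitution to multiplicativity on monomials.
\<close>

definition monomial_value :: "(var \<Rightarrow> mpoly) \<Rightarrow> (var \<Rightarrow>\<^sub>0 nat) \<Rightarrow> mpoly" where
  "monomial_value \<sigma> m = (\<Prod>v\<in>Poly_Mapping.keys m. \<sigma> v ^ Poly_Mapping.lookup m v)"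

lemma monomial_value_superset:
  assumes "finite A" "Poly_Mapping.keys m \<subseteq> A"
  shows "monomial_value \<sigma> m = (\<Prod>v\<in>A. \<sigma> v ^ Poly_Mapping.lookup m v)"
  unfolding monomial_value_def
  by (rule prod.mono_neutral_left) (use assms in \<open>auto simp: in_keys_iff\<close>)

lemma monomial_value_add: "monomial_value \<sigma> (m + m') = monomial_value \<sigma> m * monomial_value \<sigma> m'"
proof -
  let ?A = "Poly_Mapping.keys m \<union> Poly_Mapping.keys m'"
  have "monomial_value \<sigma> (m + m') = (\<Prod>v\<in>?A. \<sigma> v ^ Poly_Mapping.lookup (m + m') v)"
    by (rule monomial_value_superset) (use Poly_Mapping.keys_add[of m m'] in auto)
  also have "\<dots> = monomial_value \<sigma> m * monomial_value \<sigma> m'"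
    by (subst (1 2) monomial_value_superset[of ?A])
       (auto simp: lookup_add power_add prod.distrib)
  finally show ?thesis .
qed

lemma subst_superset:
  assumes "finite A" "Poly_Mapping.keys f \<subseteq> A"
  shows "subst \<sigma> f = (\<Sum>m\<in>A. of_int (Poly_Mapping.lookup f m) * monomial_value \<sigma> m)"
  unfolding subst_def monomial_value_def[symmetric]
  by (rule sum.mono_neutral_left) (use assms in \<open>auto simp: in_keys_iff\<close>)

lemma subst_add: "subst \<sigma> (f + g) = subst \<sigma> f + subst \<sigma> g"
proof -
  let ?A = "Poly_Mapping.keys f \<union> Poly_Mapping.keys g"
  have "subst \<sigma> (f + g) = (\<Sum>m\<in>?A. of_int (Poly_Mapping.lookup (f + g) m) * monomial_value \<sigma> m)"
    by (rule subst_superset) (use Poly_Mapping.keys_add[of f g] in auto)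
  also have "\<dots> = subst \<sigma> f + subst \<sigma> g"
    by (subst (1 2) subst_superset[of ?A]) (auto simp: lookup_add sum.distrib algebra_simps)
  finally show ?thesis .
qed

lemma subst_zero: "subst \<sigma> 0 = 0"
  by (simp add: subst_def)

lemma subst_uminus: "subst \<sigma> (- f) = - subst \<sigma> f"
  using subst_add[of \<sigma> f "- f"] by (simp add: subst_zero eq_neg_iff_add_eq_0 add.commute)

lemma subst_diff: "subst \<sigma> (f - g) = subst \<sigma> f - subst \<sigma> g"
  using subst_add[of \<sigma> f "- g"] by (simp add: subst_uminus)

lemma subst_sum: "subst \<sigma> (sum f A) = (\<Sum>i\<in>A. subst \<sigma> (f i))"
  by (induction A rule: infinite_finite_induct) (auto simp: subst_zero subst_add)

lemma subst_single: "subst \<sigma> (Poly_Mapping.single m c) = of_int c * monomial_value \<sigma> m"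
  by (subst subst_superset[of "{m}"]) (auto simp: lookup_single)

lemma subst_mult: "subst \<sigma> (f * g) = subst \<sigma> f * subst \<sigma> g"
proof -
  have single: "subst \<sigma> (Poly_Mapping.single m c * Poly_Mapping.single m' c')
      = subst \<sigma> (Poly_Mapping.single m c) * subst \<sigma> (Poly_Mapping.single m' c')" for m m' c c'
    by (simp add: mult_single subst_single monomial_value_add algebra_simps)
  let ?s = "\<lambda>f m. Poly_Mapping.single m (Poly_Mapping.lookup f m)"
  have "subst \<sigma> (f * g) =
      subst \<sigma> ((\<Sum>m\<in>Poly_Mapping.keys f. ?s f m) * (\<Sum>m\<in>Poly_Mapping.keys g. ?s g m))"
    by (simp only: sum_singles)
  also have "\<dots> = (\<Sum>m\<in>Poly_Mapping.keys f. subst \<sigma> (?s f m))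
      * (\<Sum>m\<in>Poly_Mapping.keys g. subst \<sigma> (?s g m))"
    by (simp only: sum_product subst_sum single)
  also have "\<dots> = subst \<sigma> f * subst \<sigma> g"
    by (simp only: sum_singles flip: subst_sum)
  finally show ?thesis .
qed

lemma subst_one: "subst \<sigma> 1 = 1"
  using subst_single[of \<sigma> 0 1] by (simp add: monomial_value_def)

lemma subst_power: "subst \<sigma> (f ^ k) = subst \<sigma> f ^ k"
  by (induction k) (auto simp: subst_one subst_mult)

lemma subst_prod: "subst \<sigma> (prod f A) = (\<Prod>i\<in>A. subst \<sigma> (f i))"
  by (induction A rule: infinite_finite_induct) (auto simp: subst_one subst_mult)

lemma subst_of_int: "subst \<sigma> (of_int c) = of_int c"
  using subst_single[of \<sigma> 0 c] by (simp add: monomial_value_def flip: single_of_int)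

lemma subst_of_Var: "subst \<sigma> (Var v) = \<sigma> v"
  by (simp add: Var_def subst_single monomial_value_def)

lemmas subst_hom = subst_add subst_zero subst_uminus subst_diff subst_sum subst_mult subst_one
  subst_power subst_prod subst_of_int subst_of_Var

lemma subst_subst: "subst \<sigma> (subst \<tau> f) = subst (\<lambda>v. subst \<sigma> (\<tau> v)) f"
  unfolding subst_def[of \<tau>] subst_def[of "\<lambda>v. subst \<sigma> (\<tau> v)"] by (simp add: subst_hom)


lemma Var_eq_iff: "Var u = Var v \<longleftrightarrow> u = v"
proof
  assume "Var u = Var v"
  then have "Poly_Mapping.keys (Poly_Mapping.single u (1::nat))
      = Poly_Mapping.keys (Poly_Mapping.single v (1::nat))"
    by (metis Var_def keys_single one_neq_zero singleton_inject)
  then show "u = v" by simp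
qed simp

lemma s_act_hom:
  "s_act i (f + g) = s_act i f + s_act i g"
  "s_act i (f - g) = s_act i f - s_act i g"
  "s_act i (f * g) = s_act i f * s_act i g"
  "s_act i 1 = 1"
  "s_act i (Var v) = Var (swap_var i v)"
  by (simp_all add: s_act_def subst_hom)

lemma s_act_prod: "s_act i (prod h A) = (\<Prod>a\<in>A. s_act i (h a))"
  by (simp add: s_act_def subst_hom)

lemma s_act_involutive: "s_act i (s_act i f) = f"
proof -
  have "swap_var i (swap_var i v) = v" for v by (cases v) auto
  then show ?thesis by (simp add: s_act_def subst_subst subst_of_Var subst_Var)
qed

lemma s_act_commute:
  assumes "i + 1 < j"
  shows "s_act i (s_act j f) = s_act j (s_act i f)"
proof -
  have "swap_var i (swap_var j v) = swap_var j (swap_var i v)" for v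
    using assms by (cases v) (auto simp: transpose_def)
  then show ?thesis by (simp add: s_act_def subst_subst subst_of_Var)
qed

lemma s_act_braid:
  "s_act i (s_act (i + 1) (s_act i f)) = s_act (i + 1) (s_act i (s_act (i + 1) f))"
proof -
  have "swap_var i (swap_var (i + 1) (swap_var i v))
      = swap_var (i + 1) (swap_var i (swap_var (i + 1) v))" for v
    by (cases v) (auto simp: transpose_def)
  then show ?thesis by (simp add: s_act_def subst_subst subst_of_Var)
qed


section \<open>Isobaric divided differences\<close>

text \<open>
  In the variables \<open>1 - x\<^sub>i\<close> and \<open>1 - y\<^sub>j\<close> everything becomes multiplicative: the weight
  \<open>x\<^sub>i + y\<^sub>j - x\<^sub>i y\<^sub>j\<close> is \<open>1 - (1 - x\<^sub>i) (1 - y\<^sub>j)\<close>, and \<open>pi_op i\<close> is the isobaric divided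
  difference \<open>(q f - p s\<^sub>i f) / (q - p)\<close> with \<open>p = 1 - x\<^sub>i\<close>, \<open>q = 1 - x\<^bsub>i+1\<^esub>\<close>.
\<close>

definition xbar :: "nat \<Rightarrow> mpoly" where "xbar i = 1 - xvar i"

lemma xbar_diff_nonzero: "i \<noteq> j \<Longrightarrow> xbar i - xbar j \<noteq> 0"
  by (simp add: xbar_def Var_eq_iff)

lemma s_act_xbar: "s_act i (xbar j) = xbar (transpose i (i + 1) j)"
  by (simp add: xbar_def s_act_hom)

lemma pi_op_xbar:
  "(xbar (i + 1) - xbar i) * pi_op i f = xbar (i + 1) * f - xbar i * s_act i f"
  using pi_op[of i f] s_act_xbar[of i "i + 1"] by (simp add: s_act_hom xbar_def)

lemma pi_op_eqI:
  assumes "(xbar (i + 1) - xbar i) * g = xbar (i + 1) * f - xbar i * s_act i f"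
  shows "pi_op i f = g"
proof -
  have "(xbar (i + 1) - xbar i) * pi_op i f = (xbar (i + 1) - xbar i) * g"
    using assms pi_op_xbar by simp
  then show ?thesis using xbar_diff_nonzero[of "i + 1" i] by simp
qed

lemma pi_op_add: "pi_op i (f + g) = pi_op i f + pi_op i g"
  by (rule pi_op_eqI) (simp only: distrib_left pi_op_xbar s_act_hom, simp only: algebra_simps)

lemma pi_op_diff: "pi_op i (f - g) = pi_op i f - pi_op i g"
  using pi_op_add[of i "f - g" g] by simp

lemma pi_op_symmetric:
  assumes "s_act i f = f"
  shows "pi_op i f = f"
  by (rule pi_op_eqI) (simp add: assms algebra_simps)

lemma pi_op_mult_symmetric:
  assumes "s_act i h = h"
  shows "pi_op i (h * f) = h * pi_op i f"
proof (rule pi_op_eqI)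
  have "(xbar (i + 1) - xbar i) * (h * pi_op i f) = h * ((xbar (i + 1) - xbar i) * pi_op i f)"
    by (simp only: mult.left_commute)
  also have "\<dots> = xbar (i + 1) * (h * f) - xbar i * s_act i (h * f)"
    unfolding pi_op_xbar by (simp add: s_act_hom assms algebra_simps)
  finally show "(xbar (i + 1) - xbar i) * (h * pi_op i f)
      = xbar (i + 1) * (h * f) - xbar i * s_act i (h * f)" .
qed


text \<open>
  The equation that characterises \<open>pi_op i f\<close>, transported by the ring automorphism \<open>s_act j\<close>. It
  gives access to \<open>s_act j (pi_op i f)\<close> without division.
\<close>

lemma s_act_pi_op_eq:
  "(s_act j (xbar (i + 1)) - s_act j (xbar i)) * s_act j (pi_op i f)
    = s_act j (xbar (i + 1)) * s_act j f - s_act j (xbar i) * s_act j (s_act i f)"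
  by (simp only: pi_op_xbar flip: s_act_hom)

lemma s_act_pi_op: "s_act i (pi_op i f) = pi_op i f"
proof (rule sym, rule pi_op_eqI)
  have "(xbar i - xbar (i + 1)) * s_act i (pi_op i f) = xbar i * s_act i f - xbar (i + 1) * f"
    using s_act_pi_op_eq[of i i f] by (simp add: s_act_xbar s_act_involutive)
  then show "(xbar (i + 1) - xbar i) * s_act i (pi_op i f) = xbar (i + 1) * f - xbar i * s_act i f"
    by (metis minus_diff_eq minus_mult_left)
qed

lemma pi_op_idem: "pi_op i (pi_op i f) = pi_op i f"
  by (rule pi_op_symmetric) (rule s_act_pi_op)

lemma s_act_pi_op_commute:
  assumes "i + 1 < j"
  shows "s_act i (pi_op j f) = pi_op j (s_act i f)"
proof (rule sym, rule pi_op_eqI)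
  show "(xbar (j + 1) - xbar j) * s_act i (pi_op j f)
      = xbar (j + 1) * s_act i f - xbar j * s_act j (s_act i f)"
    using s_act_pi_op_eq[of i j f] assms
    by (simp add: s_act_xbar transpose_def s_act_commute[OF assms, of f])
qed

lemma pi_op_commute:
  assumes "i + 1 < j"
  shows "pi_op i (pi_op j f) = pi_op j (pi_op i f)"
proof (rule pi_op_eqI)
  have sym: "s_act j (xbar (i + 1)) = xbar (i + 1)" "s_act j (xbar i) = xbar i"
    "s_act j (xbar (i + 1) - xbar i) = xbar (i + 1) - xbar i"
    using assms by (simp_all add: s_act_hom s_act_xbar transpose_def)
  have "(xbar (i + 1) - xbar i) * pi_op j (pi_op i f)
      = pi_op j ((xbar (i + 1) - xbar i) * pi_op i f)"
    using pi_op_mult_symmetric[OF sym(3)] by simp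
  also have "\<dots> = xbar (i + 1) * pi_op j f - xbar i * s_act i (pi_op j f)"
    using assms by (simp only: pi_op_xbar pi_op_diff pi_op_mult_symmetric[OF sym(1)]
        pi_op_mult_symmetric[OF sym(2)] s_act_pi_op_commute)
  finally show "(xbar (i + 1) - xbar i) * pi_op j (pi_op i f)
      = xbar (i + 1) * pi_op j f - xbar i * s_act i (pi_op j f)" .
qed

text \<open>
  Both sides, multiplied by the Vandermonde product of the three variables involved, expand to the
  same combination \<open>B\<close> of the six images of \<open>f\<close> under the symmetric group on these variables.
\<close>

lemma pi_op_braid: "pi_op i (pi_op (i + 1) (pi_op i f)) = pi_op (i + 1) (pi_op i (pi_op (i + 1) f))"
proof -
  define a b c where abc: "a = xbar i" "b = xbar (i + 1)" "c = xbar (i + 2)"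
  let ?s = "s_act i" and ?t = "s_act (i + 1)" and ?D = "pi_op i" and ?E = "pi_op (i + 1)"
  have act: "?s a = b" "?s b = a" "?s c = c" "?t a = a" "?t b = c" "?t c = b"
    by (simp_all add: abc s_act_xbar transpose_def)
  have D: "(b - a) * ?D g = b * g - a * ?s g" for g
    using pi_op_xbar[of i g] by (simp add: abc)
  have E: "(c - b) * ?E g = c * g - b * ?t g" for g
    using pi_op_xbar[of "i + 1" g] by (simp add: abc)
  have tD: "(c - a) * ?t (?D g) = c * ?t g - a * ?t (?s g)" for g
    using s_act_pi_op_eq[of "i + 1" i g] by (simp only: act flip: abc)
  have stD: "(c - b) * ?s (?t (?D g)) = c * ?s (?t g) - b * ?s (?t (?s g))" for g
    using arg_cong[OF tD[of g], of ?s] by (simp only: act s_act_hom)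
  have sE: "(c - a) * ?s (?E g) = c * ?s g - a * ?s (?t g)" for g
    using arg_cong[OF E[of g], of ?s] by (simp only: act s_act_hom)
  have tsE: "(b - a) * ?t (?s (?E g)) = b * ?t (?s g) - a * ?t (?s (?t g))" for g
    using arg_cong[OF sE[of g], of ?t] by (simp only: act s_act_hom)
  define B where "B = b * c\<^sup>2 * f - a * c\<^sup>2 * ?s f - b\<^sup>2 * c * ?t f + a * b\<^sup>2 * ?t (?s f)
      + a\<^sup>2 * c * ?s (?t f) - a\<^sup>2 * b * ?s (?t (?s f))"
  have "(b - a) * (c - b) * (c - a) * ?D (?E (?D f)) = B"
  proof -
    note D[of f] tD[of f] stD[of f]
    moreover have "(c - b) * ?E (?D f) = c * ?D f - b * ?t (?D f)" by (rule E)
    moreover have "(c - a) * ?s (?E (?D f)) = c * ?D f - a * ?s (?t (?D f))"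
      by (simp only: sE s_act_pi_op)
    moreover have "(b - a) * ?D (?E (?D f)) = b * ?E (?D f) - a * ?s (?E (?D f))" by (rule D)
    ultimately show ?thesis unfolding B_def by algebra
  qed
  moreover have "(b - a) * (c - b) * (c - a) * ?E (?D (?E f)) = B"
  proof -
    note E[of f] sE[of f] tsE[of f]
    moreover have "(b - a) * ?D (?E f) = b * ?E f - a * ?s (?E f)" by (rule D)
    moreover have "(c - a) * ?t (?D (?E f)) = c * ?E f - a * ?t (?s (?E f))"
      by (simp only: tD s_act_pi_op)
    moreover have "(c - b) * ?E (?D (?E f)) = c * ?D (?E f) - b * ?t (?D (?E f))" by (rule E)
    moreover have "?t (?s (?t f)) = ?s (?t (?s f))" by (simp only: s_act_braid)
    ultimately show ?thesis unfolding B_def by algebra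
  qed
  ultimately have "(b - a) * (c - b) * (c - a) * ?D (?E (?D f))
      = (b - a) * (c - b) * (c - a) * ?E (?D (?E f))"
    by simp
  moreover have "(b - a) * (c - b) * (c - a) \<noteq> 0"
    unfolding abc by (intro no_zero_divisors xbar_diff_nonzero) auto
  ultimately show ?thesis by simp
qed

definition ybar :: "nat \<Rightarrow> mpoly" where "ybar j = 1 - yvar j"

lemma weight_bar: "weight i j = 1 - xbar i * ybar j"
  by (simp add: weight_def xbar_def ybar_def algebra_simps)

lemma s_act_ybar: "s_act i (ybar j) = ybar j"
  by (simp add: ybar_def s_act_hom)

lemma s_act_weight: "s_act i (weight a b) = weight (transpose i (i + 1) a) b"
  by (simp add: weight_bar s_act_hom s_act_xbar s_act_ybar)

text \<open>
  The operator is linear over the polynomials that are symmetric in \<open>x\<^sub>i, x\<^bsub>i+1\<^esub>\<close>, and it sends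
  \<open>weight i j\<close> to \<open>1\<close>.
\<close>

lemma pi_op_weight:
  assumes "s_act i h = h"
  shows "pi_op i (weight i j * h) = h"
proof -
  have "pi_op i (weight i j) = 1"
    by (rule pi_op_eqI) (simp add: weight_bar s_act_hom s_act_xbar s_act_ybar algebra_simps)
  then show ?thesis
    using pi_op_mult_symmetric[OF assms, of "weight i j"] by (simp add: mult.commute)
qed

text \<open>
  The commutation rule behind the one nontrivial case of the transition formula: moving the
  operator past the factor attached to position \<open>i + 1\<close> turns it into the factor attached to
  position \<open>i\<close>, at the cost of one extra term.
\<close>

lemma pi_op_Leibniz:
  "pi_op i (xbar (i + 1) * ybar j * f) = xbar i * ybar j * pi_op i f + xbar (i + 1) * ybar j * f"
proof (rule pi_op_eqI)
  have "(xbar (i + 1) - xbar i) * (xbar i * ybar j * pi_op i f + xbar (i + 1) * ybar j * f)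
    = xbar i * ybar j * ((xbar (i + 1) - xbar i) * pi_op i f)
      + (xbar (i + 1) - xbar i) * (xbar (i + 1) * ybar j * f)"
    by (simp only: distrib_left ac_simps)
  also have "\<dots> = xbar (i + 1) * (xbar (i + 1) * ybar j * f) - xbar i
      * s_act i (xbar (i + 1) * ybar j * f)"
    unfolding pi_op_xbar by (simp add: s_act_hom s_act_xbar s_act_ybar algebra_simps)
  finally show "(xbar (i + 1) - xbar i) * (xbar i * ybar j * pi_op i f + xbar (i + 1) * ybar j * f)
    = xbar (i + 1) * (xbar (i + 1) * ybar j * f) - xbar i * s_act i (xbar (i + 1) * ybar j * f)" .
qed

lemma set_y_0_hom:
  "set_y_0 (f - g) = set_y_0 f - set_y_0 g"
  "set_y_0 (f * g) = set_y_0 f * set_y_0 g"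
  "set_y_0 1 = 1"
  "set_y_0 (prod h A) = (\<Prod>a\<in>A. set_y_0 (h a))"
  by (simp_all add: set_y_0_def subst_hom)

lemma set_y_0_weight: "set_y_0 (weight i j) = xvar i"
  by (simp add: weight_def set_y_0_def subst_hom)

lemma xvar_nonzero: "xvar i \<noteq> 0"
  by (simp add: Var_def)

lemma weight_nonzero: "weight i j \<noteq> 0"
  using set_y_0_weight[of i j] xvar_nonzero[of i] by (metis set_y_0_def subst_zero)


section \<open>Inversions and Bruhat covers\<close>

abbreviation adj :: "nat \<Rightarrow> nat \<Rightarrow> nat" where "adj i \<equiv> transpose i (Suc i)"

text \<open>
  The usual combinatorial description of the covers of the Bruhat order; unlike a comparison of
  numbers of inversions, it does not mention \<open>n\<close>.
\<close>

definition bruhat_cover :: "(nat \<Rightarrow> nat) \<Rightarrow> nat \<Rightarrow> nat \<Rightarrow> bool" where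
  "bruhat_cover w a b \<longleftrightarrow> w a < w b \<and> (\<forall>p. a < p \<and> p < b \<longrightarrow> \<not> (w a < w p \<and> w p < w b))"

lemma inversions_sum:
  "inversions n w = (\<Sum>i\<in>{1..n}. \<Sum>j\<in>{1..n}. of_bool (i < j \<and> w j < w i))"
proof -
  have "inversions n w = (\<Sum>x\<in>{1..n} \<times> {1..n}. of_bool (fst x < snd x \<and> w (snd x) < w (fst x)))"
    unfolding inversions_def by (subst sum_of_bool_eq) (auto intro!: arg_cong[of _ _ card])
  then show ?thesis by (simp only: sum.cartesian_product case_prod_beta')
qed

text \<open>
  Pairs of positions avoiding \<open>a\<close> and \<open>b\<close> contribute equally to both sides, the pair \<open>(a, b)\<close>
  becomes an inversion, and a third position \<open>p\<close> changes the count, by two, exactly when it lies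
  between \<open>a\<close> and \<open>b\<close> both in position and in value.
\<close>

lemma inversions_transpose:
  assumes ab: "1 \<le> a" "a < b" "b \<le> n" and inj: "inj w" and less: "w a < w b"
  shows "inversions n (w \<circ> transpose a b) =
    inversions n w + 1 + 2 * card {p. a < p \<and> p < b \<and> w a < w p \<and> w p < w b}"
proof -
  define S where "S = {1..n} - {a, b}"
  have n: "{1..n} = insert a (insert b S)" "finite S" "a \<notin> S" "b \<notin> S" "a \<noteq> b"
    using ab by (auto simp: S_def)
  have split: "(\<Sum>i\<in>{1..n}. \<Sum>j\<in>{1..n}. h i j) = (\<Sum>i\<in>S. \<Sum>j\<in>S. h i j)
      + (\<Sum>p\<in>S. h p a + h a p + h p b + h b p) + h a b + h b a + h a a + h b b"
    for h :: "nat \<Rightarrow> nat \<Rightarrow> nat"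
    unfolding n(1) using n(2-) by (simp add: sum.distrib)
  define f :: "nat \<Rightarrow> nat \<Rightarrow> nat" where "f i j = of_bool (i < j \<and> w j < w i)" for i j
  let ?w = "w \<circ> transpose a b"
  define g :: "nat \<Rightarrow> nat \<Rightarrow> nat" where "g i j = of_bool (i < j \<and> ?w j < ?w i)" for i j
  let ?B = "\<lambda>p. a < p \<and> p < b \<and> w a < w p \<and> w p < w b"
  have t: "transpose a b p = p" if "p \<in> S" for p using that by (auto simp: S_def)
  have "g i j = f i j" if "i \<in> S" "j \<in> S" for i j
    using that by (simp add: f_def g_def t)
  moreover have "g p a + g a p + g p b + g b p = f p a + f a p + f p b + f b p + 2 * of_bool (?B p)"
    if p: "p \<in> S" for p
  proof -
    have "p \<noteq> a" "p \<noteq> b" "w p \<noteq> w a" "w p \<noteq> w b" using p inj by (auto simp: S_def inj_eq)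
    then show ?thesis using ab less unfolding f_def g_def
      by (auto simp: t[OF p])
  qed
  moreover have "g a b = 1" "g b a = 0" "g a a = 0" "g b b = 0" "f a b = 0" "f b a = 0" "f a a = 0"
      "f b b = 0"
    using ab less by (auto simp: f_def g_def)
  moreover have "(\<Sum>p\<in>S. of_bool (?B p)) = card {p. ?B p}"
    using ab \<open>finite S\<close> by (subst sum_of_bool_eq) (auto simp: S_def intro!: arg_cong[of _ _ card])
  ultimately show ?thesis
    unfolding inversions_sum f_def[symmetric] g_def[symmetric] split
    by (simp add: sum.distrib flip: sum_distrib_left)
qed

lemma inversions_transpose_iff_cover:
  assumes ab: "1 \<le> a" "a < b" "b \<le> n" and inj: "inj w"
  shows "inversions n (w \<circ> transpose a b) = inversions n w + 1 \<longleftrightarrow> bruhat_cover w a b"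
proof (cases "w a < w b")
  case True
  have "finite {p. a < p \<and> p < b \<and> w a < w p \<and> w p < w b}"
    by (rule finite_subset[of _ "{..b}"]) auto
  then show ?thesis
    using True inversions_transpose[OF ab inj True] by (auto simp: bruhat_cover_def)
next
  case False
  have "w a \<noteq> w b" using ab inj by (auto simp: inj_eq)
  then have "(w \<circ> transpose a b) a < (w \<circ> transpose a b) b" using False by simp
  moreover have "inj (w \<circ> transpose a b)" using inj by (simp add: inj_compose)
  ultimately have "inversions n (w \<circ> transpose a b \<circ> transpose a b)
      > inversions n (w \<circ> transpose a b)"
    using inversions_transpose[OF ab, of "w \<circ> transpose a b"] by linarith
  then show ?thesis using False by (simp add: bruhat_cover_def comp_assoc)
qed

lemma inversions_adj:
  assumes "1 \<le> i" "i < n" "inj w" "w i < w (Suc i)"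
  shows "inversions n (w \<circ> adj i) = inversions n w + 1"
  using assms inversions_transpose_iff_cover[of i "Suc i" n w] by (simp add: bruhat_cover_def)

lemma adj_adj [simp]: "w \<circ> adj i \<circ> adj i = w"
  by (simp add: comp_assoc)

lemma permutes_transpose:
  assumes "w permutes {1..n}" "1 \<le> a" "a \<le> n" "1 \<le> b" "b \<le> n"
  shows "w \<circ> transpose a b permutes {1..n}"
  using assms by (intro permutes_compose permutes_swap_id) auto

lemma permutes_adj: "w permutes {1..n} \<Longrightarrow> 1 \<le> i \<Longrightarrow> i < n \<Longrightarrow> w \<circ> adj i permutes {1..n}"
  by (rule permutes_transpose) auto

lemma permutes_bounds:
  assumes "w permutes {1..n}" "1 \<le> i" "i \<le> n"
  shows "1 \<le> w i" "w i \<le> n"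
  using permutes_in_image[OF assms(1), of i] assms(2,3) by auto

lemma longest_permutes: "longest n permutes {1..n}"
proof -
  have "longest n (longest n i) = i" for i by (auto simp: longest_def)
  then have "\<exists>!i. longest n i = j" for j by metis
  then show ?thesis by (auto simp: permutes_def longest_def)
qed

lemma longest_longest: "longest n \<circ> longest n = id"
  by (auto simp: longest_def fun_eq_iff)

lemma inv_longest: "inv (longest n) = longest n"
  by (rule inv_equality) (auto simp: longest_def)

lemma no_ascent_imp_longest:
  assumes w: "w permutes {1..n}" and desc: "\<And>i. 1 \<le> i \<Longrightarrow> i < n \<Longrightarrow> w (Suc i) < w i"
  shows "w = longest n"
proof
  fix i
  have upper: "1 \<le> i \<Longrightarrow> i \<le> n \<Longrightarrow> w i \<le> n + 1 - i" for i
  proof (induction i)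
    case (Suc i)
    show ?case
    proof (cases "i = 0")
      case False
      then show ?thesis using Suc desc[of i] by auto
    qed (use permutes_bounds[OF w, of 1] Suc in auto)
  qed simp
  have lower: "d < n \<Longrightarrow> d + 1 \<le> w (n - d)" for d
  proof (induction d)
    case 0
    then show ?case using permutes_bounds[OF w, of n] by auto
  next
    case (Suc d)
    then have "w (n - d) < w (n - Suc d)" using desc[of "n - Suc d"] by (simp add: Suc_diff_Suc)
    then show ?case using Suc by simp
  qed
  show "w i = longest n i"
  proof (cases "i \<in> {1..n}")
    case True
    then show ?thesis using upper[of i] lower[of "n - i"] by (auto simp: longest_def)
  qed (use w in \<open>auto simp: longest_def permutes_not_in\<close>)
qed

text \<open>
  Descending induction on the number of inversions: a permutation without ascents is the longest
  one, and exchanging the values at an ascent gives a longer permutation.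
\<close>

lemma permutes_ascent_induct [consumes 1, case_names longest ascent]:
  assumes w: "w permutes {1..n}"
    and longest: "P (longest n)"
    and ascent: "\<And>w i. w permutes {1..n}
        \<Longrightarrow> (\<And>w'. w' permutes {1..n} \<Longrightarrow> inversions n w < inversions n w' \<Longrightarrow> P w') \<Longrightarrow>
      1 \<le> i \<Longrightarrow> i < n \<Longrightarrow> w i < w (Suc i) \<Longrightarrow> P (w \<circ> adj i) \<Longrightarrow> P w"
  shows "P w"
  using w
proof (induction "n * n - inversions n w" arbitrary: w rule: less_induct)
  case less
  have IH: "P w'" if "w' permutes {1..n}" "inversions n w < inversions n w'" for w'
    using that less.hyps[of w'] inversions_le[of n w'] by simp
  show ?case
  proof (cases "w = longest n")
    case False
    then obtain i where i: "1 \<le> i" "i < n" "\<not> w (Suc i) < w i"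
      using no_ascent_imp_longest[OF less.prems] by blast
    have inj: "inj w" using less.prems by (rule permutes_inj)
    then have "w i < w (Suc i)" using i by (metis inj_eq less_linear n_not_Suc_n)
    moreover from this have "P (w \<circ> adj i)"
      using inversions_adj[OF i(1,2) inj] by (intro IH permutes_adj less.prems i) auto
    ultimately show ?thesis using ascent[OF less.prems IH i(1,2)] by blast
  qed (use longest in simp)
qed

text \<open>
  The inversions \<open>(i, j)\<close> of \<open>v = inv w \<circ> longest n\<close> correspond to the non-inversions \<open>(v j, v i)\<close>
  of \<open>w\<close>.
\<close>

lemma inversions_inv_comp_longest:
  assumes w: "w permutes {1..n}"
  shows "inversions n (inv w \<circ> longest n) + inversions n w = card {(i, j). 1 \<le> i \<and> i < j \<and> j \<le> n}"
proof -
  define v where "v = inv w \<circ> longest n"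
  have v: "v permutes {1..n}"
    unfolding v_def by (intro permutes_compose longest_permutes permutes_inv w)
  let ?I = "{(i, j). 1 \<le> i \<and> i < j \<and> j \<le> n \<and> v j < v i}"
  let ?N = "{(p, q). 1 \<le> p \<and> p < q \<and> q \<le> n \<and> w p < w q}"
  let ?W = "{(i, j). 1 \<le> i \<and> i < j \<and> j \<le> n \<and> w j < w i}"
  have ll: "longest n (longest n i) = i" for i using longest_longest[of n] by (simp add: fun_eq_iff)
  have wv: "w (v i) = longest n i" and vw: "v (longest n (w i)) = i" for i
    using permutes_inverses[OF w] by (simp_all add: v_def ll)
  have longest_less: "longest n j < longest n i" "1 \<le> longest n i" "longest n j \<le> n"
    if "1 \<le> i" "i < j" "j \<le> n" for i j
    using that by (auto simp: longest_def)
  have "bij_betw (\<lambda>(i, j). (v j, v i)) ?I ?N"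
  proof (rule bij_betw_byWitness[where f' = "\<lambda>(p, q). (longest n (w q), longest n (w p))"])
    show "(\<lambda>(i, j). (v j, v i)) ` ?I \<subseteq> ?N"
      using permutes_bounds[OF v] longest_less by (auto simp: wv)
    show "(\<lambda>(p, q). (longest n (w q), longest n (w p))) ` ?N \<subseteq> ?I"
    proof clarify
      fix p q assume pq: "1 \<le> p" "p < q" "q \<le> n" "w p < w q"
      then have "1 \<le> w p" "w q \<le> n" using permutes_bounds[OF w] by auto
      then show "1 \<le> longest n (w q) \<and> longest n (w q) < longest n (w p) \<and> longest n (w p) \<le> n
          \<and> v (longest n (w p)) < v (longest n (w q))"
        using pq by (simp add: vw) (simp add: longest_def, linarith)
    qed
  qed (auto simp: wv vw ll)
  then have "inversions n v = card ?N" unfolding inversions_def by (rule bij_betw_same_card)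
  moreover have fin: "finite ?N" "finite ?W"
    by (auto intro: finite_subset[of _ "{1..n} \<times> {1..n}"])
  moreover have "{(i, j). 1 \<le> i \<and> i < j \<and> j \<le> n} = ?N \<union> ?W"
  proof -
    have "w i < w j \<or> w j < w i" if "i < j" for i j
      using that permutes_inj[OF w] by (metis inj_eq less_linear less_irrefl)
    then show ?thesis by blast
  qed
  moreover have "?N \<inter> ?W = {}" by auto
  ultimately show ?thesis by (simp add: card_Un_disjoint inversions_def flip: v_def)
qed


section \<open>Independence of the reduced word\<close>

text \<open>
  All results of the defining recursion, along any sequence of descents from the longest
  permutation. A priori \<open>w\<close> is related to several polynomials, one for each reduced word.
\<close>

inductive Groth_path :: "nat \<Rightarrow> (nat \<Rightarrow> nat) \<Rightarrow> mpoly \<Rightarrow> bool" for n where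
  base: "Groth_path n (longest n) (Groth_longest n)"
| step: "Groth_path n w f \<Longrightarrow> 1 \<le> i \<Longrightarrow> i < n \<Longrightarrow> w (Suc i) < w i \<Longrightarrow>
    Groth_path n (w \<circ> adj i) (pi_op i f)"

lemma Groth_path_permutes: "Groth_path n w f \<Longrightarrow> w permutes {1..n}"
  by (induction rule: Groth_path.induct) (blast intro: longest_permutes permutes_adj)+

lemma Groth_path_ascent:
  assumes "Groth_path n (w \<circ> adj i) f" "1 \<le> i" "i < n" "w i < w (Suc i)"
  shows "Groth_path n w (pi_op i f)"
  using Groth_path.step[OF assms(1-3)] assms(4) by simp

lemma Groth_path_exists:
  assumes "w permutes {1..n}"
  shows "\<exists>f. Groth_path n w f"
  using assms
  by (induction rule: permutes_ascent_induct) (blast intro: Groth_path.base Groth_path_ascent)+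

lemma Groth_path_cases:
  assumes "Groth_path n w f"
  obtains "w = longest n" "f = Groth_longest n"
  | i g where "1 \<le> i" "i < n" "w i < w (Suc i)" "Groth_path n (w \<circ> adj i) g" "f = pi_op i g"
  using assms
proof (cases rule: Groth_path.cases)
  case (step w' g i)
  then show ?thesis using that(2)[of i g] by simp
qed (use that(1) in simp)

text \<open>
  Independence of the path is a local confluence argument. If the last steps of two paths to \<open>w\<close>
  use ascents \<open>i \<noteq> j\<close> of \<open>w\<close>, then both can be continued upwards to a common permutation \<open>u\<close>; by
  induction the polynomial does not depend on how one descends from \<open>u\<close>, so the two paths may be
  taken to differ by a single commutation or braid relation.
\<close>

lemma Groth_path_unique:
  assumes "w permutes {1..n}"
  shows "Groth_path n w f \<Longrightarrow> Groth_path n w g \<Longrightarrow> f = g"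
  using assms
proof (induction arbitrary: f g rule: permutes_ascent_induct)
  case longest
  have no: "\<not> longest n i < longest n (Suc i)" if "1 \<le> i" "i < n" for i
    using that by (simp add: longest_def)
  have "h = Groth_longest n" if "Groth_path n (longest n) h" for h
    using that by (cases rule: Groth_path_cases) (use no in auto)
  then show ?case using longest by metis
next
  case (ascent w k)
  have inj: "inj w" using ascent.hyps(1) by (rule permutes_inj)
  have IH: "f = g" if "Groth_path n w' f" "Groth_path n w' g" "inversions n w < inversions n w'"
      for w' f g
    using ascent.IH(1)[OF Groth_path_permutes[OF that(1)] that(3) that(1,2)] .
  have not_longest: "w \<noteq> longest n"
    using ascent.hyps(2-4) by (auto simp: longest_def)
  have inv1: "inversions n w < inversions n (w \<circ> adj i)" if "1 \<le> i" "i < n" "w i < w (Suc i)" for i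
    using inversions_adj[OF that(1,2) inj that(3)] by simp
  have main: "pi_op i f = pi_op j g"
    if ij: "i \<le> j" and i: "1 \<le> i" "i < n" "w i < w (Suc i)" and j: "1 \<le> j" "j < n" "w j < w (Suc j)"
      and f: "Groth_path n (w \<circ> adj i) f" and g: "Groth_path n (w \<circ> adj j) g" for i j f g
  proof -
    consider "i = j" | "j = Suc i" | "Suc i < j" using ij by linarith
    then show ?thesis
    proof cases
      case 1
      then show ?thesis using IH f g inv1[OF i] by blast
    next
      case 2
      \<comment> \<open>\<open>w\<close> increases on three positions; \<open>?u\<close> reverses them.\<close>
      let ?u = "w \<circ> adj i \<circ> adj j \<circ> adj i"
      have u: "?u = w \<circ> adj j \<circ> adj i \<circ> adj j"
        unfolding 2 by (auto simp: fun_eq_iff transpose_def)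
      have "?u permutes {1..n}" by (intro permutes_adj ascent.hyps(1) i j)
      then obtain h where h: "Groth_path n ?u h" using Groth_path_exists by blast
      have "Groth_path n (w \<circ> adj i \<circ> adj j) (pi_op i h)"
        by (rule Groth_path_ascent[OF h]) (use i j 2 in auto)
      then have "Groth_path n (w \<circ> adj i) (pi_op j (pi_op i h))"
        by (rule Groth_path_ascent) (use i j 2 in auto)
      then have "f = pi_op j (pi_op i h)" using IH f inv1[OF i] by blast
      moreover have "Groth_path n (w \<circ> adj j \<circ> adj i) (pi_op j h)"
        by (rule Groth_path_ascent[OF h[unfolded u]]) (use i j 2 in auto)
      then have "Groth_path n (w \<circ> adj j) (pi_op i (pi_op j h))"
        by (rule Groth_path_ascent) (use i j 2 in auto)
      then have "g = pi_op i (pi_op j h)" using IH g inv1[OF j] by blast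
      ultimately show ?thesis using pi_op_braid[of i h] 2 by simp
    next
      case 3
      let ?u = "w \<circ> adj i \<circ> adj j"
      have u: "?u = w \<circ> adj j \<circ> adj i"
        using 3 by (auto simp: fun_eq_iff transpose_def)
      have "?u permutes {1..n}" by (intro permutes_adj ascent.hyps(1) i j)
      then obtain h where h: "Groth_path n ?u h" using Groth_path_exists by blast
      have "Groth_path n (w \<circ> adj i) (pi_op j h)"
        by (rule Groth_path_ascent[OF h]) (use i j 3 in auto)
      then have "f = pi_op j h" using IH f inv1[OF i] by blast
      moreover have "Groth_path n (w \<circ> adj j) (pi_op i h)"
        by (rule Groth_path_ascent[OF h[unfolded u]]) (use i j 3 in auto)
      then have "g = pi_op i h" using IH g inv1[OF j] by blast
      ultimately show ?thesis using pi_op_commute[of i j h] 3 by simp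
    qed
  qed
  obtain i f' where i: "1 \<le> i" "i < n" "w i < w (Suc i)"
      and f: "Groth_path n (w \<circ> adj i) f'" "f = pi_op i f'"
    using ascent.prems(1) not_longest by (cases rule: Groth_path_cases) auto
  obtain j g' where j: "1 \<le> j" "j < n" "w j < w (Suc j)"
      and g: "Groth_path n (w \<circ> adj j) g'" "g = pi_op j g'"
    using ascent.prems(2) not_longest by (cases rule: Groth_path_cases) auto
  show ?case
  proof (cases "i \<le> j")
    case True
    then show ?thesis using main[OF _ i j f(1) g(1)] f g by simp
  next
    case False
    then show ?thesis using main[OF _ j i g(1) f(1)] f g by simp
  qed
qed


definition word_perm :: "nat list \<Rightarrow> nat \<Rightarrow> nat" where
  "word_perm is = foldr (\<lambda>i u. transpose i (i + 1) \<circ> u) is id"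

lemma inv_comp_adj:
  assumes "w permutes {1..n}"
  shows "inv (w \<circ> adj i) = adj i \<circ> inv w"
  using permutes_bij[OF assms] by (simp add: o_inv_distrib)

lemma word_perm_Cons_iff:
  assumes "w permutes {1..n}"
  shows "word_perm (i # js) = inv w \<circ> longest n \<longleftrightarrow> word_perm js = inv (w \<circ> adj i) \<circ> longest n"
proof -
  have "adj i \<circ> u = v \<longleftrightarrow> u = adj i \<circ> v" for u v :: "nat \<Rightarrow> nat"
    unfolding fun_eq_iff comp_apply by (metis transpose_involutory)
  then show ?thesis by (simp only: word_perm_def inv_comp_adj[OF assms] foldr.simps comp_apply
      Suc_eq_plus1[symmetric] comp_assoc)
qed

lemma word_perm_Nil_iff:
  assumes "w permutes {1..n}"
  shows "word_perm [] = inv w \<circ> longest n \<longleftrightarrow> w = longest n"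
proof -
  have "w \<circ> (inv w \<circ> longest n) = longest n"
    by (simp add: fun_eq_iff permutes_inverses[OF assms])
  moreover have "inv w \<circ> w = id" by (rule permutes_inv_o(2)[OF assms])
  moreover have "word_perm [] = id" unfolding word_perm_def by simp
  ultimately show ?thesis by (metis comp_id)
qed

lemma inversions_adj_le:
  assumes "1 \<le> i" "i < n" "inj w"
  shows "inversions n (w \<circ> adj i) = inversions n w + 1 \<and> w i < w (Suc i) \<or>
    inversions n (w \<circ> adj i) < inversions n w"
proof (cases "w i < w (Suc i)")
  case False
  then have "w (Suc i) < w i" using assms(3) by (metis inj_eq linorder_neqE_nat n_not_Suc_n)
  then have "inversions n w = inversions n (w \<circ> adj i) + 1"
    using inversions_adj[of i n "w \<circ> adj i"] assms by (simp add: inj_compose)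
  then show ?thesis by simp
qed (use inversions_adj assms in simp)

text \<open>
  Each letter of a word changes the number of inversions by at most one, so no word is shorter
  than the difference of lengths. Hence along a reduced word every letter is an ascent, which is
  what the construction of a path from a reduced word needs.
\<close>

lemma word_length_bound:
  assumes "w permutes {1..n}" "set is \<subseteq> {1..<n}" "word_perm is = inv w \<circ> longest n"
  shows "inversions n (longest n) \<le> length is + inversions n w"
  using assms
proof (induction "is" arbitrary: w)
  case Nil
  then have "w = longest n" using word_perm_Nil_iff by blast
  then show ?case by simp
next
  case (Cons i js)
  let ?w = "w \<circ> adj i"
  have i: "1 \<le> i" "i < n" using Cons.prems by auto
  have "word_perm js = inv ?w \<circ> longest n" "set js \<subseteq> {1..<n}"
    using Cons.prems(2,3) word_perm_Cons_iff[OF Cons.prems(1), of i js] by (blast, force)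
  then have "inversions n (longest n) \<le> length js + inversions n ?w"
    using Cons.IH[OF permutes_adj[OF Cons.prems(1) i]] by blast
  then show ?case
    using inversions_adj_le[OF i permutes_inj[OF Cons.prems(1)]] by auto
qed

lemma reduced_word_Groth_path:
  assumes "w permutes {1..n}" "set is \<subseteq> {1..<n}" "word_perm is = inv w \<circ> longest n"
    "length is + inversions n w = inversions n (longest n)"
  shows "Groth_path n w (foldr pi_op is (Groth_longest n))"
  using assms
proof (induction "is" arbitrary: w)
  case Nil
  then have "w = longest n" using word_perm_Nil_iff by blast
  then show ?case by (simp add: Groth_path.base)
next
  case (Cons i js)
  let ?w = "w \<circ> adj i"
  have i: "1 \<le> i" "i < n" using Cons.prems by auto
  have w: "?w permutes {1..n}" "set js \<subseteq> {1..<n}" "word_perm js = inv ?w \<circ> longest n"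
    using Cons.prems(2,3) word_perm_Cons_iff[OF Cons.prems(1), of i js] permutes_adj[OF Cons.prems(1) i]
    by (blast, force, blast)
  have "inversions n (longest n) \<le> length js + inversions n ?w"
    by (rule word_length_bound[OF w])
  then have asc: "inversions n ?w = inversions n w + 1" "w i < w (Suc i)"
    using inversions_adj_le[OF i permutes_inj[OF Cons.prems(1)]] Cons.prems(4) by auto
  have "Groth_path n ?w (foldr pi_op js (Groth_longest n))"
  proof (rule Cons.IH[OF w])
    show "length js + inversions n ?w = inversions n (longest n)"
      using Cons.prems(4) asc(1) by simp
  qed
  then show ?case using Groth_path_ascent[OF _ i asc(2)] by simp
qed

lemma reduced_word_exists:
  assumes "w permutes {1..n}"
  shows "\<exists>is. set is \<subseteq> {1..<n} \<and> word_perm is = inv w \<circ> longest n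
    \<and> length is + inversions n w = inversions n (longest n)"
  using assms
proof (induction rule: permutes_ascent_induct)
  case longest
  have "word_perm [] = inv (longest n) \<circ> longest n"
    using word_perm_Nil_iff[OF longest_permutes] by blast
  then show ?case by (intro exI[of _ "[]"] conjI) auto
next
  case (ascent w i)
  then obtain js where js: "set js \<subseteq> {1..<n}" "word_perm js = inv (w \<circ> adj i) \<circ> longest n"
    "length js + inversions n (w \<circ> adj i) = inversions n (longest n)" by blast
  have "inversions n (w \<circ> adj i) = inversions n w + 1"
    using ascent.hyps permutes_inj by (intro inversions_adj) auto
  moreover have "word_perm (i # js) = inv w \<circ> longest n"
    using js(2) word_perm_Cons_iff[OF ascent.hyps(1)] by blast
  ultimately show ?case using js(1,3) ascent.hyps(2,3)
    by (intro exI[of _ "i # js"] conjI) auto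
qed

lemma reduced_word_inv_comp_longest_iff:
  assumes "w permutes {1..n}"
  shows "reduced_word n (inv w \<circ> longest n) is \<longleftrightarrow> set is \<subseteq> {1..<n} \<and>
    word_perm is = inv w \<circ> longest n \<and> length is + inversions n w = inversions n (longest n)"
proof -
  have "{(i, j). 1 \<le> i \<and> i < j \<and> j \<le> n \<and> id j < id i} = {}" by auto
  then have "inversions n id = 0" unfolding inversions_def by (simp only: card.empty)
  then have "inversions n (inv w \<circ> longest n) + inversions n w = inversions n (longest n)"
    using inversions_inv_comp_longest[OF assms] inversions_inv_comp_longest[OF longest_permutes, of n]
    by (simp add: inv_longest longest_longest)
  then have "length is + inversions n w = inversions n (longest n) \<longleftrightarrow> length is
      = inversions n (inv w \<circ> longest n)"
    by linarith
  then show ?thesis unfolding reduced_word_def word_perm_def by blast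
qed

lemma Groth_path_double_Groth:
  assumes "w permutes {1..n}"
  shows "Groth_path n w (double_Groth n w)"
proof -
  let ?is = "SOME is. reduced_word n (inv w \<circ> longest n) is"
  have "reduced_word n (inv w \<circ> longest n) ?is"
    using reduced_word_exists[OF assms] by (intro someI_ex[of "reduced_word n (inv w \<circ> longest n)"])
      (simp add: reduced_word_inv_comp_longest_iff[OF assms])
  then show ?thesis
    using reduced_word_Groth_path[OF assms, of ?is]
    by (simp add: reduced_word_inv_comp_longest_iff[OF assms] double_Groth_def pi_perm_def)
qed

lemma Groth_path_iff:
  assumes "w permutes {1..n}"
  shows "Groth_path n w f \<longleftrightarrow> f = double_Groth n w"
  using Groth_path_double_Groth[OF assms] Groth_path_unique[OF assms] by blast

text \<open>
  The action of the idempotent generator \<open>i\<close> of the 0-Hecke monoid on permutations; the operators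
  \<open>pi_op i\<close> act on double Grothendieck polynomials through it.
\<close>

definition sort_at :: "nat \<Rightarrow> (nat \<Rightarrow> nat) \<Rightarrow> nat \<Rightarrow> nat" where
  "sort_at i w = (if w (Suc i) < w i then w \<circ> adj i else w)"

lemma pi_op_double_Groth:
  assumes w: "w permutes {1..n}" and i: "1 \<le> i" "i < n"
  shows "pi_op i (double_Groth n w) = double_Groth n (sort_at i w)"
proof (cases "w (Suc i) < w i")
  case True
  then show ?thesis
    using Groth_path.step[OF Groth_path_double_Groth[OF w] i True]
    by (simp add: Groth_path_iff[OF permutes_adj[OF w i]] sort_at_def)
next
  case False
  then have asc: "w i < w (Suc i)"
    using permutes_inj[OF w] by (metis inj_eq linorder_neqE_nat n_not_Suc_n)
  have "Groth_path n w (pi_op i (double_Groth n (w \<circ> adj i)))"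
    by (rule Groth_path_ascent[OF Groth_path_double_Groth[OF permutes_adj[OF w i]] i asc])
  then have "double_Groth n w = pi_op i (double_Groth n (w \<circ> adj i))"
    by (simp add: Groth_path_iff[OF w])
  then show ?thesis using False by (simp add: sort_at_def pi_op_idem)
qed


section \<open>Dominant permutations and stability\<close>

text \<open>
  The polynomial of a dominant permutation whose code is \<open>r\<close>: the product of the weights over the
  boxes of a Young diagram with row lengths \<open>r\<close>.
\<close>

definition row_product :: "nat \<Rightarrow> (nat \<Rightarrow> nat) \<Rightarrow> mpoly" where
  "row_product N r = (\<Prod>a\<in>{1..N}. \<Prod>b\<in>{1..r a}. weight a b)"

lemma Groth_longest_row_product:
  assumes "n \<le> N"
  shows "Groth_longest n = row_product N (\<lambda>a. n - a)"
  unfolding Groth_longest_def row_product_def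
  by (subst prod.Sigma) (use assms in \<open>auto intro!: prod.cong\<close>)

lemma row_product_update:
  assumes "a \<in> {1..N}"
  shows "row_product N (r(a := Suc c)) = weight a (Suc c) * row_product N (r(a := c))"
proof -
  have "row_product N (r(a := c))
      = (\<Prod>b\<in>{1..c}. weight a b) * (\<Prod>i\<in>{1..N} - {a}. \<Prod>b\<in>{1..r i}. weight i b)" for c
    unfolding row_product_def using assms by (subst prod.remove[of _ a]) (auto intro!: prod.cong)
  then show ?thesis by (simp add: mult_ac)
qed

text \<open>
  Without the last box of row \<open>i\<close>, the rows \<open>i\<close> and \<open>i + 1\<close> have equal length, so the remaining
  product is symmetric in \<open>x\<^sub>i\<close> and \<open>x\<^bsub>i+1\<^esub>\<close>.
\<close>

lemma pi_op_row_product: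
  assumes i: "1 \<le> i" "i < N" and r: "r i = Suc (r (Suc i))"
  shows "pi_op i (row_product N r) = row_product N (r(i := r (Suc i)))"
proof -
  let ?r = "r(i := r (Suc i))"
  have "s_act i (row_product N ?r) = (\<Prod>a\<in>{1..N}. \<Prod>b\<in>{1..?r (adj i a)}. weight (adj i a) b)"
    unfolding row_product_def s_act_prod s_act_weight
    by (intro prod.cong) (auto simp: transpose_def)
  also have "\<dots> = row_product N ?r"
    unfolding row_product_def
    by (rule prod.permute[symmetric, unfolded comp_def, where p = "adj i"])
      (use i in \<open>auto intro!: permutes_swap_id\<close>)
  finally have "pi_op i (weight i (r i) * row_product N ?r) = row_product N ?r"
    by (rule pi_op_weight)
  moreover have "row_product N r = weight i (r i) * row_product N ?r"
    using row_product_update[of i N r "r (Suc i)"] i r fun_upd_triv[of r i] by simp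
  ultimately show ?thesis by simp
qed

text \<open>
  In one-line notation \<open>[n, n - 1, \<dots>, n + 1, \<dots>, 1]\<close>, with \<open>n + 1\<close> inserted at position \<open>q\<close>. These
  permutations lead from the longest element of \<open>S\<^bsub>n+1\<^esub>\<close> (\<open>q = 1\<close>) to that of \<open>S\<^sub>n\<close> (\<open>q = n + 1\<close>).
\<close>

definition lift_max :: "nat \<Rightarrow> nat \<Rightarrow> nat \<Rightarrow> nat" where
  "lift_max n q i = (if 1 \<le> i \<and> i < q then n + 1 - i else if i = q then n + 1
     else if q < i \<and> i \<le> n + 1 then n + 2 - i else i)"

lemma Groth_path_lift_max:
  assumes "1 \<le> q" "q \<le> n + 1"
  shows "Groth_path (n + 1) (lift_max n q)
    (row_product (n + 1) (\<lambda>a. if a < q then n - a else n + 1 - a))"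
  using assms
proof (induction q rule: dec_induct)
  case base
  have "lift_max n 1 = longest (n + 1)"
    by (auto simp: lift_max_def longest_def fun_eq_iff)
  moreover have "Groth_longest (n + 1)
      = row_product (n + 1) (\<lambda>a. if a < 1 then n - a else n + 1 - a)"
    unfolding Groth_longest_row_product[OF order.refl] row_product_def by (intro prod.cong) auto
  ultimately show ?case using Groth_path.base by metis
next
  case (step q)
  let ?r = "\<lambda>q a. if a < q then n - a else n + 1 - a"
  have "Groth_path (n + 1) (lift_max n q \<circ> adj q) (pi_op q (row_product (n + 1) (?r q)))"
    by (rule Groth_path.step[OF step.IH]) (use step.hyps step.prems in \<open>auto simp: lift_max_def\<close>)
  moreover have "lift_max n q \<circ> adj q = lift_max n (Suc q)"
    using step by (auto simp: lift_max_def fun_eq_iff transpose_def)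
  moreover have "pi_op q (row_product (n + 1) (?r q))
      = row_product (n + 1) ((?r q)(q := ?r q (Suc q)))"
    by (rule pi_op_row_product) (use step in auto)
  moreover have "(?r q)(q := ?r q (Suc q)) = ?r (Suc q)"
    by (auto simp: fun_eq_iff)
  ultimately show ?case by simp
qed

text \<open>
  From \<open>lift_max n p\<close> the value \<open>n + 1 - p\<close> is moved from position \<open>p + 1\<close> to position \<open>m\<close>. For
  \<open>m = n + 1\<close> the result is \<open>longest n \<circ> transpose p (n + 1)\<close>, the only element of \<open>S\<^bsub>n+1\<^esub>\<close>
  outside \<open>S\<^sub>n\<close> whose polynomial the transition formula for the longest permutation involves.
\<close>

definition drop_value :: "nat \<Rightarrow> nat \<Rightarrow> nat \<Rightarrow> nat \<Rightarrow> nat" where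
  "drop_value n p m i = (if i = p then n + 1 else if i = m then n + 1 - p
     else if 1 \<le> i \<and> i < m then n + 1 - i else if m < i \<and> i \<le> n + 1 then n + 2 - i else i)"

lemma Groth_path_drop_value:
  assumes p: "1 \<le> p" "p \<le> n" and m: "p + 1 \<le> m" "m \<le> n + 1"
  shows "Groth_path (n + 1) (drop_value n p m)
    (row_product (n + 1) (\<lambda>a. if a < m \<and> a \<noteq> p then n - a else n + 1 - a))"
  using m
proof (induction m rule: dec_induct)
  case base
  have "drop_value n p (p + 1) = lift_max n p"
    using p by (auto simp: drop_value_def lift_max_def fun_eq_iff)
  moreover have "(\<lambda>a. if a < p + 1 \<and> a \<noteq> p then n - a else n + 1 - a)
      = (\<lambda>a. if a < p then n - a else n + 1 - a)"
    by (auto simp: fun_eq_iff)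
  ultimately show ?case using Groth_path_lift_max[of p n] p by simp
next
  case (step m)
  let ?r = "\<lambda>m a. if a < m \<and> a \<noteq> p then n - a else n + 1 - a"
  have "Groth_path (n + 1) (drop_value n p m \<circ> adj m) (pi_op m (row_product (n + 1) (?r m)))"
    by (rule Groth_path.step[OF step.IH]) (use step.hyps step.prems p in \<open>auto simp: drop_value_def\<close>)
  moreover have "drop_value n p m \<circ> adj m = drop_value n p (Suc m)"
    using step p by (auto simp: drop_value_def fun_eq_iff transpose_def)
  moreover have "pi_op m (row_product (n + 1) (?r m))
      = row_product (n + 1) ((?r m)(m := ?r m (Suc m)))"
    by (rule pi_op_row_product) (use step p in auto)
  moreover have "(?r m)(m := ?r m (Suc m)) = ?r (Suc m)"
    using step by (auto simp: fun_eq_iff)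
  ultimately show ?case by simp
qed

lemma double_Groth_stable:
  assumes "w permutes {1..n}"
  shows "double_Groth (n + 1) w = double_Groth n w"
proof -
  have "Groth_path (n + 1) w f" if "Groth_path n w f" for f
    using that
  proof (induction rule: Groth_path.induct)
    case base
    have "lift_max n (n + 1) = longest n"
      by (auto simp: lift_max_def longest_def fun_eq_iff)
    moreover have "Groth_longest n
        = row_product (n + 1) (\<lambda>a. if a < n + 1 then n - a else n + 1 - a)"
      unfolding Groth_longest_row_product[OF le_add1[of n 1]] row_product_def
          by (intro prod.cong) auto
    ultimately show ?case using Groth_path_lift_max[of "n + 1" n] by simp
  next
    case (step w f i)
    show ?case by (rule Groth_path.step[OF step.IH]) (use step.hyps in auto)
  qed
  then have "Groth_path (n + 1) w (double_Groth n w)"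
    using Groth_path_double_Groth[OF assms] by blast
  moreover have "w permutes {1..n + 1}"
    by (rule permutes_subset[OF assms]) auto
  ultimately show ?thesis using Groth_path_iff by metis
qed

lemma double_Groth_longest: "double_Groth n (longest n) = Groth_longest n"
  using Groth_path.base[of n] Groth_path_iff[OF longest_permutes] by metis

lemma double_Groth_longest_transpose:
  assumes p: "1 \<le> p" "p \<le> n"
  shows "double_Groth (n + 1) (longest n \<circ> transpose p (n + 1))
      = weight p (n + 1 - p) * Groth_longest n"
proof -
  have perm: "longest n \<circ> transpose p (n + 1) permutes {1..n + 1}"
    by (intro permutes_transpose permutes_subset[OF longest_permutes]) (use p in auto)
  have "drop_value n p (n + 1) = longest n \<circ> transpose p (n + 1)"
    using p by (auto simp: drop_value_def longest_def fun_eq_iff transpose_def)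
  moreover have "row_product (n + 1) (\<lambda>a. if a < n + 1 \<and> a \<noteq> p then n - a else n + 1 - a)
      = row_product (n + 1) ((\<lambda>a. n - a)(p := Suc (n - p)))"
    unfolding row_product_def by (intro prod.cong) (use p in \<open>auto simp: Suc_diff_le\<close>)
  moreover have "\<dots> = weight p (Suc (n - p)) * row_product (n + 1) ((\<lambda>a. n - a)(p := n - p))"
    by (rule row_product_update) (use p in auto)
  moreover have "(\<lambda>a. n - a)(p := n - p) = (\<lambda>a. n - a)"
    by auto
  ultimately have "Groth_path (n + 1) (longest n \<circ> transpose p (n + 1)) (weight p (n + 1 - p)
      * Groth_longest n)"
    using Groth_path_drop_value[of p n "n + 1"] p Groth_longest_row_product[OF le_add1[of n 1]]
    by (simp add: Suc_diff_le)
  then show ?thesis using Groth_path_iff[OF perm] by simp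
qed


section \<open>Signed sums over chains at one position\<close>

text \<open>
  The signed sum \<open>\<Sum> (-1)\<^sup>j R (w t\<^bsub>p,b\<^sub>1\<^esub> \<dots> t\<^bsub>p,b\<^sub>j\<^esub>)\<close> over all saturated Bruhat chains from \<open>w\<close>,
  the empty one included, with labels \<open>b \<ge> b\<^sub>1 > \<dots> > b\<^sub>j > p\<close>. Instead of chains, the recursion
  decides for \<open>b, b - 1, \<dots>\<close> in turn whether the label is used. The function \<open>R\<close> is arbitrary so
  that identities between such sums can be proved formally, for all \<open>R\<close> at once.
\<close>

primrec descending_sum :: "((nat \<Rightarrow> nat) \<Rightarrow> 'a::ab_group_add) \<Rightarrow> nat \<Rightarrow> nat \<Rightarrow> (nat \<Rightarrow> nat) \<Rightarrow> 'a" where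
  "descending_sum R p 0 w = R w"
| "descending_sum R p (Suc b) w = (if Suc b \<le> p then R w else descending_sum R p b w
     - (if bruhat_cover w p (Suc b) then descending_sum R p b (w \<circ> transpose p (Suc b)) else 0))"

lemma descending_sum_base: "b \<le> p \<Longrightarrow> descending_sum R p b w = R w"
  by (cases b) auto

lemma descending_sum_step: "p < b \<Longrightarrow> descending_sum R p b w = descending_sum R p (b - 1) w
     - (if bruhat_cover w p b then descending_sum R p (b - 1) (w \<circ> transpose p b) else 0)"
  by (cases b) auto

declare descending_sum.simps(2) [simp del]

text \<open>
  Sorting the nonempty chains by their first, hence largest, label.
\<close>

lemma descending_sum_unroll:
  "descending_sum R p b w = R w
    - (\<Sum>b'\<in>{b'. p < b' \<and> b' \<le> b \<and> bruhat_cover w p b'}. descending_sum R p (b' - 1) (w \<circ> transpose p b'))"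
proof (induction b)
  case (Suc b)
  let ?B = "\<lambda>b. {b'. p < b' \<and> b' \<le> b \<and> bruhat_cover w p b'}"
  let ?D = "\<lambda>b'. descending_sum R p (b' - 1) (w \<circ> transpose p b')"
  show ?case
  proof (cases "p < Suc b \<and> bruhat_cover w p (Suc b)")
    case True
    then have "?B (Suc b) = insert (Suc b) (?B b)" by (auto simp: le_Suc_eq)
    moreover have "sum ?D (insert (Suc b) (?B b)) = ?D (Suc b) + sum ?D (?B b)"
      by (rule sum.insert) (auto intro: finite_subset[of _ "{..b}"])
    ultimately have "sum ?D (?B (Suc b)) = ?D (Suc b) + sum ?D (?B b)"
      by (rule trans[OF arg_cong])
    moreover have "descending_sum R p (Suc b) w = descending_sum R p b w - ?D (Suc b)"
      using True by (simp add: descending_sum.simps(2) del: comp_apply)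
    ultimately show ?thesis using Suc.IH by (simp only: diff_diff_eq add.commute)
  next
    case False
    then have "?B (Suc b) = ?B b" by (auto simp: le_Suc_eq)
    moreover have "descending_sum R p (Suc b) w = descending_sum R p b w"
      using False by (auto simp: descending_sum.simps(2) descending_sum_base)
    ultimately show ?thesis using Suc.IH by (simp only:)
  qed
next
  case 0
  have "{b'. p < b' \<and> b' \<le> 0 \<and> bruhat_cover w p b'} = {}" by auto
  then show ?case by (simp only: sum.empty descending_sum.simps(1) diff_zero)
qed

text \<open>
  Only the values of \<open>R\<close> on permutations reachable from \<open>w\<close> matter; \<open>Q\<close> is an invariant of the
  chains.
\<close>

lemma descending_sum_cong:
  assumes "Q w"
    and "\<And>u b'. Q u \<Longrightarrow> p < b' \<Longrightarrow> b' \<le> b \<Longrightarrow> bruhat_cover u p b' \<Longrightarrow> Q (u \<circ> transpose p b')"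
    and "\<And>u. Q u \<Longrightarrow> R u = R' u"
  shows "descending_sum R p b w = descending_sum R' p b w"
  using assms
proof (induction b arbitrary: w)
  case (Suc b)
  have "descending_sum R p b u = descending_sum R' p b u" if "Q u" for u
  proof (rule Suc.IH[OF that])
    show "Q (v \<circ> transpose p b')" if "Q v" "p < b'" "b' \<le> b" "bruhat_cover v p b'" for v b'
      by (rule Suc.prems(2)) (use that in simp_all)
  qed (rule Suc.prems(3))
  then show ?case
    using Suc.prems(1) Suc.prems(2)[of w "Suc b"] Suc.prems(3)[of w]
    by (simp add: descending_sum.simps(2) del: comp_apply)
qed simp

lemma descending_sum_additive:
  assumes "\<And>x y. \<phi> (x - y) = \<phi> x - \<phi> y"
  shows "descending_sum (\<lambda>u. \<phi> (R u)) p b w = \<phi> (descending_sum R p b w)"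
proof -
  have "\<phi> 0 = 0" using assms[of 0 0] by simp
  then show ?thesis
    by (induction b arbitrary: w) (simp_all add: descending_sum.simps(2) assms)
qed

lemma descending_sum_diff:
  "descending_sum (\<lambda>u. R u - R' u) p b w = descending_sum R p b w - descending_sum R' p b w"
  by (induction b arbitrary: w) (simp_all add: descending_sum.simps(2))

lemma descending_sum_zero: "descending_sum (\<lambda>u. 0) p b w = 0"
  by (induction b arbitrary: w) (simp_all add: descending_sum.simps(2))

lemma bruhat_cover_adj:
  assumes "p < b" "b < i \<or> Suc i < p \<or> p < i \<and> Suc i < b"
  shows "bruhat_cover (w \<circ> adj i) p b \<longleftrightarrow> bruhat_cover w p b"
proof -
  have "adj i p = p" "adj i b = b" using assms by (auto simp: transpose_def)
  moreover have "p < adj i q \<and> adj i q < b \<longleftrightarrow> p < q \<and> q < b" for q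
    using assms by (auto simp: transpose_def)
  ultimately have "bruhat_cover (w \<circ> adj i) p b \<Longrightarrow> bruhat_cover w p b" for w
    unfolding bruhat_cover_def by (metis comp_apply transpose_involutory)
  from this[of w] this[of "w \<circ> adj i"] show ?thesis by auto
qed

lemma transpose_adj_commute:
  "p \<notin> {i, Suc i} \<Longrightarrow> b \<notin> {i, Suc i} \<Longrightarrow> w \<circ> adj i \<circ> transpose p b = w \<circ> transpose p b \<circ> adj i"
  by (auto simp: fun_eq_iff transpose_def)

lemma descending_sum_adj:
  assumes "Suc i < p \<or> p < i \<and> b < i"
  shows "descending_sum (\<lambda>u. R (u \<circ> adj i)) p b w = descending_sum R p b (w \<circ> adj i)"
  using assms
proof (induction b arbitrary: w)
  case (Suc b)
  show ?case
  proof (cases "Suc b \<le> p")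
    case False
    have "bruhat_cover (w \<circ> adj i) p (Suc b) \<longleftrightarrow> bruhat_cover w p (Suc b)"
      by (rule bruhat_cover_adj) (use Suc.prems False in auto)
    moreover have "w \<circ> adj i \<circ> transpose p (Suc b) = w \<circ> transpose p (Suc b) \<circ> adj i"
      by (rule transpose_adj_commute) (use Suc.prems False in auto)
    moreover have "descending_sum (\<lambda>u. R (u \<circ> adj i)) p b w = descending_sum R p b (w \<circ> adj i)"
        for w
      by (rule Suc.IH) (use Suc.prems in auto)
    ultimately show ?thesis using False by (simp add: descending_sum.simps(2) del: comp_apply)
  qed (simp add: descending_sum.simps(2))
qed simp

lemma descending_sum_sort_aux:
  assumes "Suc i < p \<or> p < i \<and> b < i"
  shows "descending_sum (\<lambda>u. R (sort_at i u)) p b w = descending_sum R p b (sort_at i w)"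
proof (cases "w (Suc i) < w i")
  case True
  have "descending_sum (\<lambda>u. R (sort_at i u)) p b w = descending_sum (\<lambda>u. R (u \<circ> adj i)) p b w"
    by (rule descending_sum_cong[where Q = "\<lambda>u. u (Suc i) < u i"])
      (use assms True in \<open>auto simp: sort_at_def\<close>)
  then show ?thesis using descending_sum_adj[OF assms] True by (simp add: sort_at_def)
next
  case False
  have "descending_sum (\<lambda>u. R (sort_at i u)) p b w = descending_sum R p b w"
    by (rule descending_sum_cong[where Q = "\<lambda>u. \<not> u (Suc i) < u i"])
      (use assms False in \<open>auto simp: sort_at_def\<close>)
  then show ?thesis using False by (simp add: sort_at_def)
qed

text \<open>
  The heart of the commutation with \<open>sort_at i\<close> for \<open>p < i\<close>. Let \<open>d, x, y\<close> be the values of \<open>w\<close> at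
  \<open>p\<close>, \<open>i\<close>, \<open>i + 1\<close>, so \<open>y < x\<close>. On each side at most four terms survive, according to which of
  the labels \<open>i + 1\<close> and \<open>i\<close> are used. If \<open>y < d\<close>, they match one by one. If \<open>d < y\<close>, then
  starting from \<open>w\<close> the direct step from \<open>d\<close> to \<open>x\<close> and the two steps from \<open>d\<close> over \<open>y\<close> to \<open>x\<close> are
  possible under the same condition, end in permutations with the same sorted form, and cancel.
\<close>

lemma descending_sum_sort_Suc:
  assumes pi: "p < i" and desc: "w (Suc i) < w i" and inj: "inj w"
  shows "descending_sum (\<lambda>u. R (sort_at i u)) p (Suc i) w = descending_sum R p (Suc i) (w \<circ> adj i)"
proof -
  define T where "T = descending_sum R p (i - 1)"
  define d x y where "d = w p" and "x = w i" and "y = w (Suc i)"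
  define v where "v = w \<circ> adj i"
  define I where "I d a \<longleftrightarrow> d < a \<and> (\<forall>q. p < q \<and> q < i \<longrightarrow> \<not> (d < w q \<and> w q < a))" for d a
  have yx: "y < x" and dy: "d \<noteq> y" and dx: "d \<noteq> x"
    using desc inj pi by (auto simp: d_def x_def y_def inj_eq)
  have cover_i: "bruhat_cover u p i \<longleftrightarrow> I (u p) (u i)"
    and cover_Suc: "bruhat_cover u p (Suc i)
        \<longleftrightarrow> I (u p) (u (Suc i)) \<and> \<not> (u p < u i \<and> u i < u (Suc i))"
    if "\<And>q. p < q \<Longrightarrow> q < i \<Longrightarrow> u q = w q" for u
    using that pi unfolding bruhat_cover_def I_def by (auto simp: less_Suc_eq)
  have cov: "bruhat_cover v p i \<longleftrightarrow> I d y" "bruhat_cover v p (Suc i) \<longleftrightarrow> I d x \<and> y < d"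
    "\<not> bruhat_cover (v \<circ> transpose p (Suc i)) p i"
    "bruhat_cover w p i \<longleftrightarrow> I d x" "bruhat_cover w p (Suc i) \<longleftrightarrow> I d y"
    "bruhat_cover (w \<circ> transpose p (Suc i)) p i \<longleftrightarrow> I y x"
  proof -
    have "v p = d" "v i = y" "v (Suc i) = x" "w p = d" "w i = x" "w (Suc i) = y"
      using pi by (simp_all add: v_def d_def x_def y_def)
    then show "bruhat_cover v p i \<longleftrightarrow> I d y" "bruhat_cover v p (Suc i) \<longleftrightarrow> I d x \<and> y < d"
      "\<not> bruhat_cover (v \<circ> transpose p (Suc i)) p i"
      "bruhat_cover w p i \<longleftrightarrow> I d x" "bruhat_cover w p (Suc i) \<longleftrightarrow> I d y"
      "bruhat_cover (w \<circ> transpose p (Suc i)) p i \<longleftrightarrow> I y x"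
      using pi yx dy
      by (subst cover_i cover_Suc; auto simp: v_def I_def; fail)+
  qed
  have sorted: "descending_sum (\<lambda>u. R (sort_at i u)) p (i - 1) u = T (sort_at i u)" for u
    unfolding T_def by (rule descending_sum_sort_aux) (use pi in auto)
  have sort_w: "sort_at i w = v"
    using desc by (simp add: sort_at_def v_def)
  have sort_i: "sort_at i (w \<circ> transpose p i)
      = (if y < d then v \<circ> transpose p (Suc i) else w \<circ> transpose p i)"
  proof -
    have "w \<circ> transpose p i \<circ> adj i = v \<circ> transpose p (Suc i)"
      using pi by (auto simp: v_def fun_eq_iff transpose_def)
    then show ?thesis using pi by (simp add: sort_at_def d_def y_def del: comp_apply) simp
  qed
  have sort_Suc: "sort_at i (w \<circ> transpose p (Suc i)) = v \<circ> transpose p i"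
    "sort_at i (w \<circ> transpose p (Suc i) \<circ> transpose p i) = w \<circ> transpose p i" if "d < y"
  proof -
    have "w \<circ> transpose p (Suc i) \<circ> adj i = v \<circ> transpose p i"
      "w \<circ> transpose p (Suc i) \<circ> transpose p i \<circ> adj i = w \<circ> transpose p i"
      using pi by (auto simp: v_def fun_eq_iff transpose_def)
    moreover have "(w \<circ> transpose p (Suc i)) (Suc i) = d" "(w \<circ> transpose p (Suc i)) i = x"
      "(w \<circ> transpose p (Suc i) \<circ> transpose p i) (Suc i) = d"
      "(w \<circ> transpose p (Suc i) \<circ> transpose p i) i = y"
      using pi by (auto simp: d_def x_def y_def)
    ultimately show "sort_at i (w \<circ> transpose p (Suc i)) = v \<circ> transpose p i"
      "sort_at i (w \<circ> transpose p (Suc i) \<circ> transpose p i) = w \<circ> transpose p i"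
      using that yx unfolding sort_at_def by (simp_all only: if_True less_trans[OF that yx])
  qed
  have two: "descending_sum R' p (Suc i) u =
      descending_sum R' p (i - 1) u
      - (if bruhat_cover u p i then descending_sum R' p (i - 1) (u \<circ> transpose p i) else 0)
      - (if bruhat_cover u p (Suc i) then descending_sum R' p (i - 1) (u \<circ> transpose p (Suc i))
          - (if bruhat_cover (u \<circ> transpose p (Suc i)) p i
             then descending_sum R' p (i - 1) (u \<circ> transpose p (Suc i) \<circ> transpose p i) else 0)
         else 0)" for R' :: "(nat \<Rightarrow> nat) \<Rightarrow> 'a" and u
    using pi by (simp add: descending_sum_step[of p "Suc i"]
        descending_sum_step[of p i] del: comp_apply)
  show ?thesis
  proof (cases "y < d")
    case True
    then have "\<not> I d y" by (simp add: I_def)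
    then show ?thesis using True
      unfolding two v_def[symmetric] cov sorted sort_w sort_i T_def[symmetric] using cov(3)
          by (simp del: comp_apply)
  next
    case False
    then have "d < y" using dy by simp
    moreover have "I d x \<longleftrightarrow> I d y \<and> I y x"
    proof -
      have "w q \<noteq> y" if "q < i" for q using that inj by (auto simp: y_def inj_eq)
      then show ?thesis using \<open>d < y\<close> yx unfolding I_def by (meson less_trans linorder_neqE_nat)
    qed
    ultimately show ?thesis
      unfolding two v_def[symmetric] cov sorted T_def[symmetric]
          using sort_w sort_i sort_Suc False cov(3)
      by (simp del: comp_apply)
  qed
qed

lemma descending_sum_sort:
  assumes i: "Suc i < p \<or> p < i \<and> Suc i \<le> b" and desc: "w (Suc i) < w i" and inj: "inj w"
  shows "descending_sum (\<lambda>u. R (sort_at i u)) p b w = descending_sum R p b (w \<circ> adj i)"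
proof (cases "Suc i < p")
  case True
  then show ?thesis using descending_sum_sort_aux[of i p b R w] desc by (simp add: sort_at_def)
next
  case False
  then have "Suc i \<le> b" and pi: "p < i" using i by auto
  from this(1) show ?thesis using desc inj
  proof (induction b arbitrary: w rule: dec_induct)
    case base
    then show ?case using descending_sum_sort_Suc[OF pi] by blast
  next
    case (step b)
    have "bruhat_cover (w \<circ> adj i) p (Suc b) \<longleftrightarrow> bruhat_cover w p (Suc b)"
      by (rule bruhat_cover_adj) (use step.hyps pi in auto)
    moreover have "w \<circ> adj i \<circ> transpose p (Suc b) = w \<circ> transpose p (Suc b) \<circ> adj i"
      by (rule transpose_adj_commute) (use step.hyps pi in auto)
    moreover have "descending_sum (\<lambda>u. R (sort_at i u)) p b w = descending_sum R p b (w \<circ> adj i)"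
      by (rule step.IH[OF step.prems])
    moreover have "descending_sum (\<lambda>u. R (sort_at i u)) p b (w \<circ> transpose p (Suc b))
        = descending_sum R p b (w \<circ> transpose p (Suc b) \<circ> adj i)"
      by (rule step.IH[OF _ inj_compose[OF step.prems(2) inj_transpose]]) (use step.prems step.hyps pi in auto)
    ultimately show ?case
      using step.hyps pi by (simp add: descending_sum.simps(2) del: comp_apply)
  qed
qed

text \<open>
  Compares chains at position \<open>p\<close>, starting from an ascent \<open>p\<close> of \<open>w\<close>, with chains at position
  \<open>p + 1\<close> of the permutation \<open>u = w \<circ> adj p\<close>. The former cannot jump over the value \<open>w (p + 1)\<close>;
  they stop below it or end with the label \<open>p + 1\<close>, which accounts for the two terms of the
  difference. The chains of \<open>u\<close> that do pass that value end in permutations with an ascent at \<open>p\<close>,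
  which are fixed by \<open>sort_at p\<close> and therefore contribute nothing.
\<close>

lemma descending_sum_shift:
  assumes "Suc p \<le> b" "w p < w (Suc p)" "inj w"
  shows "descending_sum R p b w = descending_sum (\<lambda>u. R (sort_at p u) - R u) (Suc p) b (w \<circ> adj p)"
  using assms
proof (induction b arbitrary: w rule: dec_induct)
  case base
  have "bruhat_cover w p (Suc p)" using base by (auto simp: bruhat_cover_def)
  moreover have "sort_at p (w \<circ> adj p) = w" using base by (simp add: sort_at_def)
  ultimately show ?case by (simp add: descending_sum.simps(2) descending_sum_base del: comp_apply)
next
  case (step b)
  let ?R = "\<lambda>u. R (sort_at p u) - R u" and ?w = "w \<circ> adj p"
  have between: "(\<forall>q. p < q \<and> q < Suc b \<longrightarrow> P q) \<longleftrightarrow> P (Suc p) \<and> (\<forall>q. Suc p < q \<and> q < Suc b \<longrightarrow> P q)"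
      for P
    using step.hyps by (metis Suc_lessI le_imp_less_Suc lessI less_trans)
  have above: "?w q = w q" if "Suc p < q" for q
    using that by (auto simp: transpose_def)
  have cov: "bruhat_cover w p (Suc b) \<longleftrightarrow> bruhat_cover ?w (Suc p) (Suc b) \<and> \<not> w (Suc p) < w (Suc b)"
    unfolding bruhat_cover_def between using step.prems step.hyps above by auto
  have perm: "?w \<circ> transpose (Suc p) (Suc b) = w \<circ> transpose p (Suc b) \<circ> adj p"
    using step.hyps by (auto simp: fun_eq_iff transpose_def)
  have vanish: "descending_sum ?R (Suc p) b u = 0" if "u p < u (Suc p)" for u
  proof -
    have "descending_sum ?R (Suc p) b u = descending_sum (\<lambda>_. 0) (Suc p) b u"
      by (rule descending_sum_cong[where Q = "\<lambda>u. u p < u (Suc p)"])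
        (use that in \<open>auto simp: sort_at_def bruhat_cover_def\<close>)
    then show ?thesis by (simp add: descending_sum_zero)
  qed
  have IH: "descending_sum R p b w = descending_sum ?R (Suc p) b ?w"
    by (rule step.IH[OF step.prems])
  show ?case
  proof (cases "bruhat_cover ?w (Suc p) (Suc b)")
    case True
    show ?thesis
    proof (cases "w (Suc p) < w (Suc b)")
      case less: True
      have "descending_sum ?R (Suc p) b (?w \<circ> transpose (Suc p) (Suc b)) = 0"
        by (rule vanish) (use less step.hyps in simp)
      then show ?thesis using cov less True IH step.hyps
        by (simp add: descending_sum.simps(2) del: comp_apply)
    next
      case False
      moreover have "w (Suc b) \<noteq> w (Suc p)" using step.prems step.hyps by (auto simp: inj_eq)
      ultimately have less: "w (Suc b) < w (Suc p)" by simp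
      have "descending_sum R p b (w \<circ> transpose p (Suc b))
          = descending_sum ?R (Suc p) b (w \<circ> transpose p (Suc b) \<circ> adj p)"
        by (rule step.IH[OF _ inj_compose[OF step.prems(2) inj_transpose]]) (use less step.hyps in auto)
      then show ?thesis using cov False True IH step.hyps
        by (simp add: descending_sum.simps(2) perm del: comp_apply)
    qed
  qed (use cov IH step.hyps in \<open>simp add: descending_sum.simps(2) del: comp_apply\<close>)
qed


lemma descending_sum_no_cover:
  assumes "\<And>b'. p < b' \<Longrightarrow> b' \<le> b \<Longrightarrow> \<not> bruhat_cover w p b'"
  shows "descending_sum R p b w = R w"
proof -
  have none: "{b'. p < b' \<and> b' \<le> b \<and> bruhat_cover w p b'} = {}" using assms by blast
  show ?thesis by (subst descending_sum_unroll) (simp only: none sum.empty diff_zero)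
qed


section \<open>The transition formula\<close>

lemma pi_op_descending_sum:
  assumes w: "w permutes {1..N}" and p: "1 \<le> p" and b: "b \<le> N" and i: "1 \<le> i" "i < N"
  shows "pi_op i (descending_sum (double_Groth N) p b w)
      = descending_sum (\<lambda>u. double_Groth N (sort_at i u)) p b w"
proof -
  have "descending_sum (\<lambda>u. double_Groth N (sort_at i u)) p b w
      = descending_sum (\<lambda>u. pi_op i (double_Groth N u)) p b w"
  proof (rule descending_sum_cong[where Q = "\<lambda>u. u permutes {1..N}"])
    show "u \<circ> transpose p b' permutes {1..N}" if "u permutes {1..N}" "p < b'" "b' \<le> b" for u b'
      by (rule permutes_transpose) (use that p b in auto)
  qed (use w i pi_op_double_Groth in auto)
  also have "\<dots> = pi_op i (descending_sum (double_Groth N) p b w)"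
    by (rule descending_sum_additive) (rule pi_op_diff)
  finally show ?thesis ..
qed

text \<open>
  From the longest element of \<open>S\<^sub>n\<close> the only nonempty chain is the single step with label \<open>n + 1\<close>,
  so the formula compares two explicit products. This is why the polynomials are taken in
  \<open>S\<^bsub>n+1\<^esub>\<close>: within \<open>S\<^sub>n\<close> the formula fails when all values larger than \<open>w p\<close> lie to the left of
  \<open>p\<close>.
\<close>

lemma transition_longest:
  assumes p: "1 \<le> p" "p \<le> n"
  shows "xbar p * ybar (longest n p) * double_Groth (n + 1) (longest n)
    = descending_sum (double_Groth (n + 1)) p (n + 1) (longest n)"
proof -
  let ?G = "double_Groth (n + 1)" and ?u = "longest n \<circ> transpose p (n + 1)"
  have "bruhat_cover (longest n) p (n + 1)"
    using p by (auto simp: bruhat_cover_def longest_def)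
  then have "descending_sum ?G p (n + 1) (longest n)
      = descending_sum ?G p n (longest n) - descending_sum ?G p n ?u"
    using p by (simp add: descending_sum.simps(2) del: comp_apply)
  also have "descending_sum ?G p n (longest n) = ?G (longest n)"
    by (rule descending_sum_no_cover) (use p in \<open>auto simp: bruhat_cover_def longest_def\<close>)
  also have "descending_sum ?G p n ?u = ?G ?u"
    by (rule descending_sum_no_cover) (use p in \<open>auto simp: bruhat_cover_def longest_def\<close>)
  also have "?G ?u = weight p (n + 1 - p) * Groth_longest n"
    by (rule double_Groth_longest_transpose[OF p])
  also have "?G (longest n) = Groth_longest n"
    by (simp only: double_Groth_stable[OF longest_permutes] double_Groth_longest)
  finally have "descending_sum ?G p (n + 1) (longest n)
      = xbar p * ybar (n + 1 - p) * Groth_longest n"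
    by (simp add: weight_bar algebra_simps)
  moreover have "longest n p = n + 1 - p" using p by (simp add: longest_def)
  ultimately show ?thesis by (simp only: double_Groth_stable[OF longest_permutes] double_Groth_longest)
qed

text \<open>
  The transition formula at a left-to-right minimum \<open>p\<close> of \<open>w\<close>. Left-to-right minima, rather than
  just the first position that does not carry its maximal value, are needed for the induction: an
  ascent \<open>i = p\<close> leads to the position \<open>p + 1\<close> of the longer permutation, which is again a
  left-to-right minimum. The case \<open>i + 1 = p\<close> cannot occur.
\<close>

theorem transition:
  assumes "w permutes {1..n}" "1 \<le> p" "p \<le> n" "\<And>a. 1 \<le> a \<Longrightarrow> a < p \<Longrightarrow> w p < w a"
  shows "xbar p * ybar (w p) * double_Groth (n + 1) w
      = descending_sum (double_Groth (n + 1)) p (n + 1) w"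
  using assms
proof (induction arbitrary: p rule: permutes_ascent_induct)
  case longest
  show ?case using longest(1,2) by (rule transition_longest)
next
  case (ascent w i)
  let ?G = "double_Groth (n + 1)" and ?D = "descending_sum (double_Groth (n + 1))"
  define w' where "w' = w \<circ> adj i"
  note IH = ascent.IH(2)[folded w'_def]
  have ww': "w = w' \<circ> adj i" and desc: "w' (Suc i) < w' i" and sort: "sort_at i w' = w"
    using ascent.hyps by (simp_all add: w'_def sort_at_def)
  have perm: "w' permutes {1..n}" "w' permutes {1..n + 1}"
    unfolding w'_def using ascent.hyps permutes_adj
        by (blast, intro permutes_subset[OF permutes_adj[of w n i]]) auto
  have inj: "inj w" "inj w'" using ascent.hyps(1) perm(1) permutes_inj by blast+
  have G: "pi_op i (?G w') = ?G w"
    using pi_op_double_Groth[OF perm(2), of i] ascent.hyps sort by simp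
  have pi_D: "pi_op i (?D q (n + 1) w') = descending_sum (\<lambda>u. ?G (sort_at i u)) q (n + 1) w'"
      if "1 \<le> q" for q
    using ascent.hyps that by (intro pi_op_descending_sum perm) auto
  have "Suc i \<noteq> p" using ascent.prems(3)[of i] ascent.hyps by auto
  then consider "Suc i < p \<or> p < i" | "i = p" by linarith
  then show ?case
  proof cases
    case 1
    have adj_p: "adj i p = p" using 1 by (auto simp: transpose_def)
    have w'p: "w' p = w p" by (simp add: w'_def adj_p)
    have "xbar p * ybar (w p) * ?G w = xbar p * ybar (w p) * pi_op i (?G w')"
      by (simp only: G)
    also have "\<dots> = pi_op i (xbar p * ybar (w p) * ?G w')"
      by (rule pi_op_mult_symmetric[symmetric]) (simp add: s_act_hom s_act_xbar s_act_ybar adj_p)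
    also have "xbar p * ybar (w p) * ?G w' = ?D p (n + 1) w'"
      unfolding w'p[symmetric]
    proof (rule IH)
      show "w' p < w' a" if "1 \<le> a" "a < p" for a
      proof -
        have "1 \<le> adj i a" "adj i a < p" using 1 that ascent.hyps by (auto simp: transpose_def)
        then show ?thesis using ascent.prems(3)[of "adj i a"] w'p by (simp add: w'_def)
      qed
    qed (use ascent.prems in auto)
    also have "pi_op i (?D p (n + 1) w') = descending_sum (\<lambda>u. ?G (sort_at i u)) p (n + 1) w'"
      by (rule pi_D) (rule ascent.prems(1))
    also have "\<dots> = ?D p (n + 1) w"
      unfolding ww' by (rule descending_sum_sort[OF _ desc inj(2)]) (use 1 ascent.hyps in auto)
    finally show ?thesis .
  next
    case 2
    let ?c = "xbar (Suc p) * ybar (w p)"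
    have IH': "?c * ?G w' = ?D (Suc p) (n + 1) w'"
    proof -
      have "w' (Suc p) = w p" using 2 by (simp add: w'_def)
      moreover have "w' (Suc p) < w' a" if "1 \<le> a" "a < Suc p" for a
        using that 2 ascent.hyps ascent.prems(3)[of a]
            by (cases "a = p") (auto simp: w'_def transpose_def)
      ultimately show ?thesis using IH[of "Suc p"] 2 ascent.hyps by simp
    qed
    have "?D p (n + 1) w = descending_sum (\<lambda>u. ?G (sort_at p u) - ?G u) (Suc p) (n + 1) w'"
      unfolding w'_def 2 by (rule descending_sum_shift) (use 2 ascent.hyps ascent.prems inj in auto)
    also have "\<dots> = pi_op p (?c * ?G w') - ?c * ?G w'"
      unfolding IH' descending_sum_diff using pi_D[of "Suc p"] 2 by simp
    also have "\<dots> = xbar p * ybar (w p) * pi_op p (?G w')"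
      using pi_op_Leibniz[of p "w p" "?G w'"] by simp
    finally show ?thesis using G 2 by simp
  qed
qed


section \<open>Marked chains in one k-Bruhat order\<close>

lemma chain_end_append: "chain_end u (c @ d) = chain_end (chain_end u c) d"
  by (induction u c rule: chain_end.induct) (simp_all del: comp_apply)

text \<open>
  The local form of the condition on segments: an unmarked cover must continue the increasing
  segment of its predecessor.
\<close>

definition may_follow :: "label \<times> bool \<Rightarrow> label \<times> bool \<Rightarrow> bool" where
  "may_follow d e \<longleftrightarrow> snd e \<or> fst (fst d) < fst (fst e) \<or>
     fst (fst d) = fst (fst e) \<and> snd (fst e) < snd (fst d)"

lemma segments_increasing_iff:
  "(\<forall>s\<in>set (segments c). increasing s) \<longleftrightarrow> successively may_follow c"
proof (induction c rule: segments.induct)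
  case (2 e c)
  let ?t = "takeWhile (\<lambda>d. \<not> snd d) c" and ?d = "dropWhile (\<lambda>d. \<not> snd d) c"
  have unmarked: "increasing (map fst (e # t)) \<longleftrightarrow> successively may_follow (e # t)"
    if "\<forall>d\<in>set t. \<not> snd d" for t and e :: "label \<times> bool"
    using that
    by (induction t arbitrary: e) (auto simp: increasing_def may_follow_def case_prod_beta)
  have "increasing (map fst (e # ?t)) \<longleftrightarrow> successively may_follow (e # ?t)"
    by (rule unmarked) (auto dest: set_takeWhileD)
  moreover have "?d = [] \<or> may_follow x (hd ?d)" for x
    using hd_dropWhile[of "\<lambda>d. \<not> snd d" c] by (auto simp: may_follow_def)
  then have "successively may_follow ((e # ?t) @ ?d) \<longleftrightarrow>
      successively may_follow (e # ?t) \<and> successively may_follow ?d"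
    by (auto simp only: successively_append_iff)
  ultimately show ?case using 2 by simp
qed simp

text \<open>
  The shape of the permutations at the end of the part of a climbing chain in the \<open>k\<close>-Bruhat
  order.
\<close>

definition has_top_prefix :: "nat \<Rightarrow> nat \<Rightarrow> (nat \<Rightarrow> nat) \<Rightarrow> bool" where
  "has_top_prefix n k w \<longleftrightarrow> w permutes {1..n} \<and> (\<forall>i. 1 \<le> i \<and> i \<le> k \<longrightarrow> w i = n + 1 - i)"

lemma has_top_prefix_right:
  assumes w: "has_top_prefix n m w" and b: "m < b" "b \<le> n"
  shows "w b \<le> n - m"
proof (rule ccontr)
  assume neg: "\<not> w b \<le> n - m"
  have wb: "w b \<le> n" using w b permutes_bounds[of w n b] by (simp add: has_top_prefix_def)
  moreover have "w (n + 1 - w b) = n + 1 - (n + 1 - w b)"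
  proof -
    have "1 \<le> n + 1 - w b" "n + 1 - w b \<le> m" using neg b wb by linarith+
    then show ?thesis using w unfolding has_top_prefix_def by blast
  qed
  ultimately have "w (n + 1 - w b) = w b" by simp
  then have "n + 1 - w b = b" using w permutes_inj by (metis has_top_prefix_def inj_eq)
  then show False using neg b by linarith
qed

text \<open>
  The positions \<open>1, \<dots>, m\<close> carry the \<open>m\<close> largest values, so no cover can raise them: the part of a
  climbing chain in the \<open>m + 1\<close>-Bruhat order only raises position \<open>m + 1\<close>.
\<close>

lemma chain_step:
  assumes w: "has_top_prefix n m w" and step: "1 \<le> a" "a \<le> Suc m" "Suc m < b" "b \<le> n"
  shows "inversions n (w \<circ> transpose a b) = inversions n w + 1
    \<longleftrightarrow> a = Suc m \<and> bruhat_cover w (Suc m) b"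
proof -
  have inj: "inj w" using w permutes_inj by (auto simp: has_top_prefix_def)
  have "a = Suc m" if "bruhat_cover w a b"
  proof (rule ccontr)
    assume "a \<noteq> Suc m"
    then have "w a = n + 1 - a" "a \<le> m" using w step by (auto simp: has_top_prefix_def)
    then show False using that has_top_prefix_right[OF w, of b] step
        by (auto simp: bruhat_cover_def)
  qed
  then show ?thesis using inversions_transpose_iff_cover[of a b n w] step inj by auto
qed

lemma has_top_prefix_transpose:
  assumes "has_top_prefix n m w" "m < a" "a \<le> n" "m < b" "b \<le> n"
  shows "has_top_prefix n m (w \<circ> transpose a b)"
  unfolding has_top_prefix_def
proof
  show "w \<circ> transpose a b permutes {1..n}"
    by (rule permutes_transpose) (use assms in \<open>auto simp: has_top_prefix_def\<close>)
qed (use assms in \<open>auto simp: has_top_prefix_def\<close>)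

text \<open>
  The possible continuations of a marked chain in the \<open>k\<close>-Bruhat order after a cover with label
  \<open>(k, b)\<close>. As no label \<open>b'\<close> satisfies \<open>b' < 0\<close>, the choice \<open>b = 0\<close> forces the first cover to be
  marked and gives all marked chains.
\<close>

definition stage_chains :: "nat \<Rightarrow> nat \<Rightarrow> nat \<Rightarrow> (nat \<Rightarrow> nat) \<Rightarrow> marked_chain set" where
  "stage_chains n k b w = {c. is_chain n k w (map fst c) \<and>
     (\<forall>i\<in>{1..k}. chain_end w (map fst c) i = n + 1 - i) \<and> successively may_follow (((k, b), True) # c)}"

lemma may_follow_mark: "may_follow (l, m) e \<longleftrightarrow> may_follow (l, True) e"
  by (simp add: may_follow_def)

lemma Cons_in_stage_chains_iff:
  assumes w: "has_top_prefix n m w"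
  shows "((a, b'), M) # c \<in> stage_chains n (Suc m) b w \<longleftrightarrow>
    a = Suc m \<and> b' \<in> {b'. Suc m < b' \<and> b' \<le> n \<and> bruhat_cover w (Suc m) b'} \<and> (M \<or> b' < b)
      \<and> c \<in> stage_chains n (Suc m) b' (w \<circ> transpose (Suc m) b')"
proof -
  have "successively may_follow (((k, b'), M) # c) \<longleftrightarrow> successively may_follow (((k, b'), True) # c)"
      for k
    by (cases c) (simp_all add: may_follow_mark[of _ M])
  then show ?thesis
    using chain_step[OF w, of a b']
    unfolding stage_chains_def by (auto simp: may_follow_def simp del: comp_apply)
qed

lemma Nil_in_stage_chains_iff:
  assumes w: "has_top_prefix n m w"
  shows "[] \<in> stage_chains n (Suc m) b w \<longleftrightarrow> w (Suc m) = n - m"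
proof -
  have "(\<forall>i\<in>{1..Suc m}. w i = n + 1 - i) \<longleftrightarrow> (\<forall>i\<in>{1..m}. w i = n + 1 - i) \<and> w (Suc m) = n + 1 - Suc m"
    by (auto simp: atLeastAtMostSuc_conv)
  then show ?thesis using w by (auto simp: stage_chains_def has_top_prefix_def)
qed

text \<open>
  The contribution of a marked chain, collected from its covers: a marked cover divides by its
  weight, an unmarked one changes the sign.
\<close>

fun chain_weight :: "(mpoly \<Rightarrow> 'f::field) \<Rightarrow> (nat \<Rightarrow> nat) \<Rightarrow> marked_chain \<Rightarrow> 'f" where
  "chain_weight \<phi> u [] = 1"
| "chain_weight \<phi> u (((a, b), m) # c) =
     (if m then 1 / \<phi> (weight a (u a)) else - 1) * chain_weight \<phi> (u \<circ> transpose a b) c"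

lemma chain_weight_append:
  "chain_weight \<phi> u (c @ d) = chain_weight \<phi> u c * chain_weight \<phi> (chain_end u (map fst c)) d"
  by (induction \<phi> u c rule: chain_weight.induct) (simp_all add: mult.assoc del: comp_apply)

text \<open>
  The sum over chains is evaluated in a field, under a ring homomorphism \<open>\<phi>\<close> that does not kill
  the denominators. Leaving \<open>\<phi>\<close> open yields the double polynomials and their specialisation at
  \<open>y = 0\<close> from one argument, without specialising fractions.
\<close>

definition weight_hom :: "(mpoly \<Rightarrow> 'f::field) \<Rightarrow> bool" where
  "weight_hom \<phi> \<longleftrightarrow> (\<forall>f g. \<phi> (f - g) = \<phi> f - \<phi> g) \<and> (\<forall>f g. \<phi> (f * g) = \<phi> f * \<phi> g) \<and> \<phi> 1 = 1
     \<and> (\<forall>i j. \<phi> (weight i j) \<noteq> 0)"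

text \<open>
  The transition formula solved for the nonempty chains. The label \<open>n + 1\<close> does not occur: the
  value \<open>n - m\<close> lies to the right of position \<open>m + 1\<close> and blocks the cover.
\<close>

lemma transition_image:
  assumes \<phi>: "weight_hom \<phi>" and w: "has_top_prefix n m w" and m: "m < n"
      and less: "w (Suc m) < n - m"
  defines "g \<equiv> \<lambda>u. \<phi> (double_Groth (n + 1) u)"
  shows "\<phi> (weight (Suc m) (w (Suc m))) * g w =
    (\<Sum>b'\<in>{b'. Suc m < b' \<and> b' \<le> n \<and> bruhat_cover w (Suc m) b'}.
      descending_sum g (Suc m) (b' - 1) (w \<circ> transpose (Suc m) b'))"
proof -
  let ?p = "Suc m"
  have perm: "w permutes {1..n}" and top: "\<And>i. 1 \<le> i \<Longrightarrow> i \<le> m \<Longrightarrow> w i = n + 1 - i"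
    using w by (auto simp: has_top_prefix_def)
  have "w ?p < w a" if "1 \<le> a" "a < ?p" for a
    using that top[of a] less by auto
  then have "xbar ?p * ybar (w ?p) * double_Groth (n + 1) w
      = descending_sum (double_Groth (n + 1)) ?p (n + 1) w"
    by (intro transition[OF perm]) (use m in auto)
  moreover have "descending_sum g ?p (n + 1) w
      = \<phi> (descending_sum (double_Groth (n + 1)) ?p (n + 1) w)"
    unfolding g_def by (rule descending_sum_additive) (use \<phi> in \<open>simp add: weight_hom_def\<close>)
  moreover have "\<phi> (xbar ?p * ybar (w ?p) * double_Groth (n + 1) w)
      = \<phi> (xbar ?p * ybar (w ?p)) * g w"
    using \<phi> by (simp only: weight_hom_def g_def)
  ultimately have image: "\<phi> (xbar ?p * ybar (w ?p)) * g w = descending_sum g ?p (n + 1) w"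
    by simp
  have weight: "\<phi> (weight ?p (w ?p)) = 1 - \<phi> (xbar ?p * ybar (w ?p))"
    using \<phi> by (simp add: weight_bar weight_hom_def)
  have "\<phi> (weight ?p (w ?p)) * g w = g w - descending_sum g ?p (n + 1) w"
    unfolding weight left_diff_distrib image by simp
  also have "\<dots> = (\<Sum>b'\<in>{b'. ?p < b' \<and> b' \<le> n + 1 \<and> bruhat_cover w ?p b'}.
      descending_sum g ?p (b' - 1) (w \<circ> transpose ?p b'))"
    unfolding descending_sum_unroll[of g ?p "n + 1" w]
        by (simp only: diff_diff_eq2 add_diff_cancel_left')
  also have "{b'. ?p < b' \<and> b' \<le> n + 1 \<and> bruhat_cover w ?p b'}
      = {b'. ?p < b' \<and> b' \<le> n \<and> bruhat_cover w ?p b'}"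
  proof -
    have "\<not> bruhat_cover w ?p (n + 1)"
    proof
      assume cov: "bruhat_cover w ?p (n + 1)"
      \<comment> \<open>This value lies strictly between \<open>w (m + 1)\<close> and \<open>n + 1\<close>.\<close>
      obtain q where q: "w q = n - m" using permutes_surj[OF perm] surjD by metis
      have "q \<in> {1..n}" using q m less permutes_in_image[OF perm, of q] by auto
      moreover have "q \<noteq> ?p" using q less by auto
      moreover have "\<not> q \<le> m" using top[of q] q \<open>q \<in> {1..n}\<close> m by auto
      ultimately have "?p < q" "q < n + 1" by auto
      moreover have "w (n + 1) = n + 1" by (rule permutes_not_in[OF perm]) simp
      ultimately show False using cov q less unfolding bruhat_cover_def by auto
    qed
    then show ?thesis by (auto simp: le_Suc_eq)
  qed
  finally show ?thesis .
qed

text \<open>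
  Descending induction on the number of inversions. If position \<open>m + 1\<close> is at its maximum, only
  the empty chain is left. Otherwise the first cover has some label \<open>b'\<close>, and the continuations
  sum up to \<open>descending_sum\<close> with bound \<open>b' - 1\<close>. If the cover is marked, \<open>b'\<close> is arbitrary, and
  by the transition formula all these terms together, divided by the weight, give \<open>g w\<close>. If it is
  unmarked, \<open>b' < b\<close>, and the terms subtract the nonempty chains with labels below \<open>b\<close>. What
  remains is the unrolled \<open>descending_sum\<close> with bound \<open>b - 1\<close>.
\<close>

lemma stage_chains_sum:
  assumes \<phi>: "weight_hom \<phi>" and m: "m < n" and b: "b \<le> n + 1" and w: "has_top_prefix n m w"
  defines "g \<equiv> \<lambda>u. \<phi> (double_Groth (n + 1) u)"
  shows "finite (stage_chains n (Suc m) b w) \<and>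
    (\<Sum>c\<in>stage_chains n (Suc m) b w. chain_weight \<phi> w c * g (chain_end w (map fst c)))
      = descending_sum g (Suc m) (b - 1) w"
  using w b
proof (induction "n * n - inversions n w" arbitrary: w b rule: less_induct)
  case less
  note w = less.prems(1)
  let ?p = "Suc m"
  let ?S = "\<lambda>b w. \<Sum>c\<in>stage_chains n ?p b w. chain_weight \<phi> w c * g (chain_end w (map fst c))"
  define B where "B = {b'. ?p < b' \<and> b' \<le> n \<and> bruhat_cover w ?p b'}"
  define t where "t b' = w \<circ> transpose ?p b'" for b'
  define Ext where "Ext M b' = (\<lambda>c. ((?p, b'), M) # c) ` stage_chains n ?p b' (t b')" for M b'
  have "finite B" unfolding B_def by (rule finite_subset[of _ "{..n}"]) auto
  have IH: "finite (stage_chains n ?p b' (t b')) \<and> ?S b' (t b')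
      = descending_sum g ?p (b' - 1) (t b')"
    if "b' \<in> B" for b'
  proof (rule less.hyps)
    have "inversions n (t b') = inversions n w + 1"
      using chain_step[OF w, of ?p b'] that m by (simp add: B_def t_def)
    then show "n * n - inversions n (t b') < n * n - inversions n w"
      using inversions_le[of n "t b'"] by simp
    show "has_top_prefix n m (t b')"
      unfolding t_def by (rule has_top_prefix_transpose[OF w]) (use that m in \<open>auto simp: B_def\<close>)
    show "b' \<le> n + 1" using that by (simp add: B_def)
  qed
  have wp: "w ?p \<le> n - m" using has_top_prefix_right[OF w, of ?p] m by simp
  show ?case
  proof (cases "w ?p = n - m")
    case True
    have no_cover: "\<not> bruhat_cover w ?p b'" if "?p < b'" "b' \<le> n" for b'
      using that has_top_prefix_right[OF w, of b'] True by (auto simp: bruhat_cover_def)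
    have "c = []" if c: "c \<in> stage_chains n ?p b w" for c
    proof (cases c)
      case (Cons e d)
      obtain a b' M where "e = ((a, b'), M)" by (metis prod.exhaust)
      then show ?thesis using c no_cover[of b'] Cons_in_stage_chains_iff[OF w, of a b' M d b] Cons
          by blast
    qed
    moreover have "[] \<in> stage_chains n ?p b w" using True
        by (simp only: Nil_in_stage_chains_iff[OF w])
    ultimately have "stage_chains n ?p b w = {[]}" by blast
    moreover have "descending_sum g ?p (b - 1) w = g w"
      by (rule descending_sum_no_cover) (use no_cover less.prems in auto)
    ultimately show ?thesis by simp
  next
    case False
    then have lt: "w ?p < n - m" using wp by simp
    have eq: "stage_chains n ?p b w
        = (\<Union>b'\<in>B. Ext True b') \<union> (\<Union>b'\<in>{b' \<in> B. b' < b}. Ext False b')" (is "?L = ?T \<union> ?F")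
    proof (rule set_eqI)
      fix c
      show "c \<in> ?L \<longleftrightarrow> c \<in> ?T \<union> ?F"
      proof (cases c)
        case Nil
        then show ?thesis using Nil_in_stage_chains_iff[OF w, of b] False by (auto simp: Ext_def)
      next
        case (Cons e d)
        obtain a b' M where e: "e = ((a, b'), M)" by (metis prod.exhaust)
        show ?thesis
          unfolding Cons e Cons_in_stage_chains_iff[OF w] B_def[symmetric] t_def[symmetric]
          by (cases M) (auto simp: Ext_def)
      qed
    qed
    have fin: "finite (Ext M b')" if "b' \<in> B" for M b'
      using IH[OF that] by (simp add: Ext_def)
    have sum_Ext: "(\<Sum>c\<in>(\<Union>b'\<in>A. Ext M b'). chain_weight \<phi> w c * g (chain_end w (map fst c)))
      = (if M then 1 / \<phi> (weight ?p (w ?p)) else - 1) * (\<Sum>b'\<in>A. descending_sum g ?p (b' - 1) (t b'))"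
      if "A \<subseteq> B" for A M
    proof -
      have "(\<Sum>c\<in>(\<Union>b'\<in>A. Ext M b'). chain_weight \<phi> w c * g (chain_end w (map fst c)))
        = (\<Sum>b'\<in>A. \<Sum>c\<in>Ext M b'. chain_weight \<phi> w c * g (chain_end w (map fst c)))"
        by (rule sum.UNION_disjoint)
          (use that finite_subset[OF that \<open>finite B\<close>] fin in \<open>auto simp: Ext_def\<close>)
      also have "\<dots> = (\<Sum>b'\<in>A. (if M then 1 / \<phi> (weight ?p (w ?p)) else - 1) * ?S b' (t b'))"
      proof (rule sum.cong[OF refl])
        fix b' assume "b' \<in> A"
        have "inj_on (\<lambda>c. ((?p, b'), M) # c) (stage_chains n ?p b' (t b'))"
            by (simp add: inj_on_def)
        then show "(\<Sum>c\<in>Ext M b'. chain_weight \<phi> w c * g (chain_end w (map fst c)))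
          = (if M then 1 / \<phi> (weight ?p (w ?p)) else - 1) * ?S b' (t b')"
          unfolding Ext_def sum_distrib_left t_def
          by (subst sum.reindex) (simp_all only: o_def
               chain_weight.simps list.map fst_conv chain_end.simps mult.assoc)
      qed
      also have "\<dots> = (\<Sum>b'\<in>A. (if M then 1 / \<phi> (weight ?p (w ?p)) else - 1)
          * descending_sum g ?p (b' - 1) (t b'))"
        using IH that by (intro sum.cong) auto
      finally show ?thesis by (simp only: sum_distrib_left)
    qed
    have "?S b w = (\<Sum>c\<in>?T. chain_weight \<phi> w c * g (chain_end w (map fst c)))
        + (\<Sum>c\<in>?F. chain_weight \<phi> w c * g (chain_end w (map fst c)))"
      unfolding eq by (rule sum.union_disjoint) (use \<open>finite B\<close> fin in \<open>auto simp: Ext_def\<close>)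
    also have "\<dots> = 1 / \<phi> (weight ?p (w ?p)) * (\<Sum>b'\<in>B. descending_sum g ?p (b' - 1) (t b'))
        - (\<Sum>b'\<in>{b' \<in> B. b' < b}. descending_sum g ?p (b' - 1) (t b'))"
      by (subst (1 2) sum_Ext) auto
    also have "(\<Sum>b'\<in>B. descending_sum g ?p (b' - 1) (t b')) = \<phi> (weight ?p (w ?p)) * g w"
      using transition_image[OF \<phi> w m lt] by (simp only: B_def t_def g_def)
    also have "{b' \<in> B. b' < b} = {b'. ?p < b' \<and> b' \<le> b - 1 \<and> bruhat_cover w ?p b'}"
      using less.prems(2) by (auto simp: B_def)
    also have "1 / \<phi> (weight ?p (w ?p)) * (\<phi> (weight ?p (w ?p)) * g w) = g w"
      using \<phi> by (simp add: weight_hom_def)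
    also have "g w - (\<Sum>b'\<in>{b'. ?p < b' \<and> b' \<le> b - 1 \<and> bruhat_cover w ?p b'}.
        descending_sum g ?p (b' - 1) (t b'))
        = descending_sum g ?p (b - 1) w"
      unfolding t_def by (rule descending_sum_unroll[symmetric])
    finally show ?thesis using eq fin \<open>finite B\<close> by auto
  qed
qed


section \<open>Climbing chains\<close>

lemma in_stage_chains_0_iff:
  "c \<in> stage_chains n k 0 w \<longleftrightarrow>
    is_marked_chain n k w c \<and> (\<forall>i\<in>{1..k}. chain_end w (map fst c) i = n + 1 - i)"
proof (cases c)
  case (Cons e d)
  obtain a b M where e: "e = ((a, b), M)" by (metis prod.exhaust)
  have "may_follow ((k, 0), True) e \<longleftrightarrow> M" if "a \<le> k"
    using that by (auto simp: e may_follow_def)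
  moreover have "a \<le> k" if "is_chain n k w (map fst c)"
    using that by (simp add: Cons e del: comp_apply)
  moreover have "successively may_follow (((k, 0), True) # c) \<longleftrightarrow>
      may_follow ((k, 0), True) e \<and> successively may_follow c"
    by (simp add: Cons)
  moreover have "(c \<noteq> [] \<longrightarrow> snd (hd c)) \<longleftrightarrow> M" by (simp add: Cons e)
  ultimately show ?thesis
    unfolding stage_chains_def is_marked_chain_def segments_increasing_iff mem_Collect_eq by blast
qed (simp add: stage_chains_def is_marked_chain_def)

text \<open>
  The part of being a chain that the weights of covers depend on; it makes no reference to the
  \<open>k\<close>-Bruhat order and can be stated for the concatenation of all parts.
\<close>

primrec ascending :: "(nat \<Rightarrow> nat) \<Rightarrow> label list \<Rightarrow> bool" where
  "ascending u [] \<longleftrightarrow> True"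
| "ascending u (l # c) \<longleftrightarrow> fst l < snd l \<and> u (fst l) < u (snd l)
    \<and> ascending (u \<circ> transpose (fst l) (snd l)) c"

lemma ascending_append: "ascending u (c @ d) \<longleftrightarrow> ascending u c \<and> ascending (chain_end u c) d"
  by (induction u c rule: chain_end.induct) (simp_all del: comp_apply)

lemma stage_chain_structure:
  assumes "c \<in> stage_chains n (Suc m) b w" "has_top_prefix n m w" "m < n"
  shows "has_top_prefix n (Suc m) (chain_end w (map fst c)) \<and> ascending w (map fst c)
    \<and> (\<forall>e\<in>set c. fst (fst e) = Suc m)"
  using assms
proof (induction c arbitrary: w b)
  case Nil
  then show ?case by (auto simp: stage_chains_def has_top_prefix_def)
next
  case (Cons e c)
  obtain a b' M where e: "e = ((a, b'), M)" by (metis prod.exhaust)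
  have step: "a = Suc m" "Suc m < b'" "b' \<le> n" "bruhat_cover w (Suc m) b'"
    and c: "c \<in> stage_chains n (Suc m) b' (w \<circ> transpose (Suc m) b')"
    using Cons.prems(1) unfolding e Cons_in_stage_chains_iff[OF Cons.prems(2)] by blast+
  have "has_top_prefix n m (w \<circ> transpose (Suc m) b')"
    by (rule has_top_prefix_transpose[OF Cons.prems(2)]) (use step Cons.prems in auto)
  from Cons.IH[OF c this Cons.prems(3)] step e show ?case
    by (simp add: bruhat_cover_def del: comp_apply)
qed

text \<open>
  The first \<open>m\<close> parts of climbing marked chains, so that the sum can be evaluated by induction on
  \<open>m\<close>.
\<close>

definition partial_climbs :: "nat \<Rightarrow> (nat \<Rightarrow> nat) \<Rightarrow> nat \<Rightarrow> marked_chain list set" where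
  "partial_climbs n w m = {\<gamma>. length \<gamma> = m \<and>
     (\<forall>j<m. \<gamma> ! j \<in> stage_chains n (Suc j) 0 (stage w \<gamma> j))}"

lemma stage_append: "j \<le> length \<gamma> \<Longrightarrow> stage w (\<gamma> @ [c]) j = stage w \<gamma> j"
  by (simp add: stage_def)

lemma stage_Suc: "j < length \<gamma> \<Longrightarrow> stage w \<gamma> (Suc j) = chain_end (stage w \<gamma> j) (map fst (\<gamma> ! j))"
  by (simp add: stage_def take_Suc_conv_app_nth chain_end_append)

lemma partial_climbs_Suc:
  "partial_climbs n w (Suc m) =
    (\<lambda>(\<gamma>, c). \<gamma> @ [c]) ` (SIGMA \<gamma>:partial_climbs n w m. stage_chains n (Suc m) 0 (stage w \<gamma> m))"
proof -
  have "\<gamma> @ [c] \<in> partial_climbs n w (Suc m) \<longleftrightarrow>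
      \<gamma> \<in> partial_climbs n w m \<and> c \<in> stage_chains n (Suc m) 0 (stage w \<gamma> m)" for \<gamma> c
    unfolding partial_climbs_def
    by (auto simp: nth_append stage_append less_Suc_eq all_conj_distrib)
  moreover have "\<exists>\<gamma>' c. \<gamma> = \<gamma>' @ [c]" if "\<gamma> \<in> partial_climbs n w (Suc m)" for \<gamma>
    using that by (cases \<gamma> rule: rev_cases) (auto simp: partial_climbs_def)
  ultimately show ?thesis by (auto simp: image_iff) metis
qed

text \<open>
  The alternative \<open>m = 0\<close> is there for \<open>n = 0\<close>, where the number \<open>n - 1\<close> of parts is not below
  \<open>n\<close>.
\<close>

lemma partial_climb_structure:
  assumes "w permutes {1..n}" "m < n \<or> m = 0" "\<gamma> \<in> partial_climbs n w m"
  shows "has_top_prefix n m (stage w \<gamma> m) \<and> ascending w (map fst (concat \<gamma>))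
    \<and> (\<forall>j<m. \<forall>e\<in>set (\<gamma> ! j). fst (fst e) = Suc j)"
  using assms(2,3)
proof (induction m arbitrary: \<gamma>)
  case 0
  then show ?case using assms(1) by (simp add: partial_climbs_def has_top_prefix_def stage_def)
next
  case (Suc m)
  then obtain \<delta> c where \<gamma>: "\<gamma> = \<delta> @ [c]" and \<delta>: "\<delta> \<in> partial_climbs n w m"
    and c: "c \<in> stage_chains n (Suc m) 0 (stage w \<delta> m)"
    unfolding partial_climbs_Suc by auto
  have len: "length \<delta> = m" using \<delta> by (simp add: partial_climbs_def)
  have IH: "has_top_prefix n m (stage w \<delta> m)" "ascending w (map fst (concat \<delta>))"
    "\<forall>j<m. \<forall>e\<in>set (\<delta> ! j). fst (fst e) = Suc j"
    using Suc.IH[OF _ \<delta>] Suc.prems(1) by auto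
  have "stage w \<gamma> (Suc m) = chain_end (stage w \<delta> m) (map fst c)"
    using stage_Suc[of m \<gamma> w] len by (simp add: \<gamma> stage_append nth_append)
  moreover have "stage w \<delta> m = chain_end w (map fst (concat \<delta>))"
    using len by (simp add: stage_def)
  ultimately show ?case
    using stage_chain_structure[OF c IH(1)] IH Suc.prems(1) len
    by (auto simp: \<gamma> ascending_append nth_append less_Suc_eq)
qed

text \<open>
  The sum telescopes: summing over the last part replaces the polynomial of the permutation after
  stage \<open>m + 1\<close> by that of the permutation after stage \<open>m\<close>.
\<close>

lemma partial_climbs_sum:
  fixes \<phi> :: "mpoly \<Rightarrow> 'f::field"
  assumes \<phi>: "weight_hom \<phi>" and w: "w permutes {1..n}" and m: "m < n \<or> m = 0"
  defines "g \<equiv> \<lambda>u. \<phi> (double_Groth (n + 1) u)"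
  shows "finite (partial_climbs n w m) \<and>
    (\<Sum>\<gamma>\<in>partial_climbs n w m. chain_weight \<phi> w (concat \<gamma>) * g (stage w \<gamma> m)) = g w"
  using m
proof (induction m)
  case 0
  have "partial_climbs n w 0 = {[]}" by (auto simp: partial_climbs_def)
  then show ?case by (simp add: stage_def)
next
  case (Suc m)
  then have mn: "m < n" by simp
  let ?P = "partial_climbs n w m" and ?S = "\<lambda>\<gamma>. stage_chains n (Suc m) 0 (stage w \<gamma> m)"
  have stage_sum: "finite (?S \<gamma>)"
    "(\<Sum>c\<in>?S \<gamma>. chain_weight \<phi> (stage w \<gamma> m) c * g (chain_end (stage w \<gamma> m) (map fst c)))
        = g (stage w \<gamma> m)"
    if "\<gamma> \<in> ?P" for \<gamma>
    using stage_chains_sum[OF \<phi> mn, of 0 "stage w \<gamma> m"] partial_climb_structure[OF w _ that] mn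
    by (simp_all add: g_def)
  have len: "length \<gamma> = m" if "\<gamma> \<in> ?P" for \<gamma> using that by (simp add: partial_climbs_def)
  have "(\<Sum>\<gamma>\<in>partial_climbs n w (Suc m). chain_weight \<phi> w (concat \<gamma>) * g (stage w \<gamma> (Suc m)))
    = (\<Sum>(\<gamma>, c)\<in>(SIGMA \<gamma>:?P. ?S \<gamma>). chain_weight \<phi> w (concat (\<gamma> @ [c])) * g (stage w (\<gamma> @ [c]) (Suc m)))"
    unfolding partial_climbs_Suc by (subst sum.reindex) (auto simp: inj_on_def case_prod_beta)
  also have "\<dots> = (\<Sum>\<gamma>\<in>?P. \<Sum>c\<in>?S \<gamma>. chain_weight \<phi> w (concat (\<gamma> @ [c]))
      * g (stage w (\<gamma> @ [c]) (Suc m)))"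
    by (rule sum.Sigma[symmetric]) (use Suc stage_sum in auto)
  also have "\<dots> = (\<Sum>\<gamma>\<in>?P. chain_weight \<phi> w (concat \<gamma>) *
      (\<Sum>c\<in>?S \<gamma>. chain_weight \<phi> (stage w \<gamma> m) c * g (chain_end (stage w \<gamma> m) (map fst c))))"
  proof (rule sum.cong[OF refl])
    fix \<gamma> assume "\<gamma> \<in> ?P"
    then have "stage w (\<gamma> @ [c]) (Suc m) = chain_end (stage w \<gamma> m) (map fst c)" for c
      using stage_Suc[of m "\<gamma> @ [c]" w] len by (simp add: stage_append nth_append)
    moreover have "chain_end w (map fst (concat \<gamma>)) = stage w \<gamma> m"
      using len[OF \<open>\<gamma> \<in> ?P\<close>] by (simp add: stage_def)
    ultimately show "(\<Sum>c\<in>?S \<gamma>. chain_weight \<phi> w (concat (\<gamma> @ [c])) * g (stage w (\<gamma> @ [c]) (Suc m)))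
      = chain_weight \<phi> w (concat \<gamma>) *
      (\<Sum>c\<in>?S \<gamma>. chain_weight \<phi> (stage w \<gamma> m) c * g (chain_end (stage w \<gamma> m) (map fst c)))"
      by (simp add: chain_weight_append sum_distrib_left mult.assoc)
  qed
  also have "\<dots> = (\<Sum>\<gamma>\<in>?P. chain_weight \<phi> w (concat \<gamma>) * g (stage w \<gamma> m))"
    by (intro sum.cong refl) (simp add: stage_sum)
  also have "\<dots> = g w" using Suc by simp
  finally show ?case
    using Suc stage_sum unfolding partial_climbs_Suc by auto
qed

lemma climbing_marked_chains_eq:
  assumes "w permutes {1..n}"
  shows "climbing_marked_chains n w = partial_climbs n w (n - 1)"
proof -
  have "\<gamma> \<in> climbing_marked_chains n w \<longleftrightarrow> \<gamma> \<in> partial_climbs n w (n - 1) \<and> stage w \<gamma> (n - 1)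
      = longest n" for \<gamma>
  proof -
    have "(\<forall>k\<in>{1..<n}. is_marked_chain n k (stage w \<gamma> (k - 1)) (\<gamma> ! (k - 1)) \<and>
        (\<forall>i\<in>{1..k}. stage w \<gamma> k i = n + 1 - i)) \<longleftrightarrow>
      (\<forall>j<n - 1. \<gamma> ! j \<in> stage_chains n (Suc j) 0 (stage w \<gamma> j))" if "length \<gamma> = n - 1"
    proof -
      have "{1..<n} = Suc ` {..<n - 1}"
        by (cases n) (auto simp: image_Suc_lessThan)
      then show ?thesis
        using that by (simp add: in_stage_chains_0_iff stage_Suc lessThan_def)
    qed
    then show ?thesis unfolding climbing_marked_chains_def partial_climbs_def by auto
  qed
  moreover have "stage w \<gamma> (n - 1) = longest n" if "\<gamma> \<in> partial_climbs n w (n - 1)" for \<gamma>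
  proof -
    have top: "has_top_prefix n (n - 1) (stage w \<gamma> (n - 1))"
      using partial_climb_structure[OF assms _ that] by (cases n) auto
    have "stage w \<gamma> (n - 1) (Suc i) < stage w \<gamma> (n - 1) i" if "1 \<le> i" "i < n" for i
    proof -
      have i: "stage w \<gamma> (n - 1) i = n + 1 - i" using top that by (simp add: has_top_prefix_def)
      have "has_top_prefix n i (stage w \<gamma> (n - 1))" using top that
          by (auto simp: has_top_prefix_def)
      then have "stage w \<gamma> (n - 1) (Suc i) \<le> n - i"
        by (rule has_top_prefix_right) (use that in auto)
      then show ?thesis using i that by simp
    qed
    then show ?thesis
      using top by (intro no_ascent_imp_longest) (auto simp: has_top_prefix_def)
  qed
  ultimately show ?thesis by blast
qed

theorem climbing_sum:
  fixes \<phi> :: "mpoly \<Rightarrow> 'f::field"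
  assumes \<phi>: "weight_hom \<phi>" and w: "w permutes {1..n}"
  shows "\<phi> (double_Groth n w) =
    (\<Sum>\<gamma>\<in>climbing_marked_chains n w. chain_weight \<phi> w (concat \<gamma>) * \<phi> (Groth_longest n))"
proof -
  have "\<phi> (double_Groth (n + 1) w) = (\<Sum>\<gamma>\<in>partial_climbs n w (n - 1).
      chain_weight \<phi> w (concat \<gamma>) * \<phi> (double_Groth (n + 1) (stage w \<gamma> (n - 1))))"
    using partial_climbs_sum[OF \<phi> w, of "n - 1"] by (cases n) auto
  also have "\<dots> = (\<Sum>\<gamma>\<in>partial_climbs n w (n - 1). chain_weight \<phi> w (concat \<gamma>) * \<phi> (Groth_longest n))"
  proof (intro sum.cong refl)
    fix \<gamma> assume "\<gamma> \<in> partial_climbs n w (n - 1)"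
    then have "stage w \<gamma> (n - 1) = longest n"
      using climbing_marked_chains_eq[OF w] by (auto simp: climbing_marked_chains_def)
    then show "chain_weight \<phi> w (concat \<gamma>) * \<phi> (double_Groth (n + 1) (stage w \<gamma> (n - 1)))
      = chain_weight \<phi> w (concat \<gamma>) * \<phi> (Groth_longest n)"
      by (simp only: double_Groth_stable[OF longest_permutes] double_Groth_longest)
  qed
  finally show ?thesis
    by (simp only: climbing_marked_chains_eq[OF w] double_Groth_stable[OF w])
qed


section \<open>Weights of chains\<close>

lemma lower_index_transpose:
  assumes "a < b"
  shows "lower_index (transpose a b) = a"
  unfolding lower_index_def
proof (rule the_equality)
  fix i assume "\<exists>k>i. transpose a b = transpose i k"
  then obtain k where k: "i < k" "transpose a b = transpose i k" by blast
  then have "transpose a b i = k" by simp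
  then show "i = a" using k(1) assms by (auto simp: transpose_def split: if_splits)
qed (use assms in auto)

text \<open>
  The conjugate of the transposition of \<open>a, b\<close> by \<open>u\<close> is the transposition of the values
  \<open>u a < u b\<close>, so the weight of a cover is determined by the raised position and its old value.
\<close>

lemma cover_weight_transpose:
  assumes "bij u" "a < b" "u a < u b"
  shows "cover_weight u (u \<circ> transpose a b) = weight a (u a)"
proof -
  have "inv u \<circ> (u \<circ> transpose a b) = transpose a b"
    using assms(1) by (simp add: fun_eq_iff bij_is_inj)
  moreover have "u \<circ> transpose a b \<circ> inv u = transpose (u a) (u b)"
    using transpose_comp_eq[OF bij_imp_bij_inv[OF assms(1)], of "u a" "u b"] assms(1)
    by (simp add: fun_eq_iff bij_is_inj inv_inv_eq transpose_def) (metis bij_inv_eq_iff)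
  ultimately show ?thesis using assms by (simp add: cover_weight_def lower_index_transpose)
qed

text \<open>
  The denominator \<^const>\<open>mu\<close> for a flat list of covers, which admits induction.
\<close>

definition mu_list :: "(nat \<Rightarrow> nat) \<Rightarrow> marked_chain \<Rightarrow> mpoly" where
  "mu_list u c = (\<Prod>p\<in>{p. p < length c \<and> snd (c ! p)}.
     cover_weight (chain_end u (map fst (take p c))) (chain_end u (map fst (take (p + 1) c))))"

lemma mu_list_Cons:
  assumes "bij u" "a < b" "u a < u b"
  shows "mu_list u (((a, b), M) # c)
      = (if M then weight a (u a) else 1) * mu_list (u \<circ> transpose a b) c"
proof -
  let ?e = "((a, b), M)"
  let ?I = "{p. p < length c \<and> snd (c ! p)}"
  let ?F = "\<lambda>p. cover_weight (chain_end u (map fst (take p (?e # c))))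
      (chain_end u (map fst (take (p + 1) (?e # c))))"
  have "{p. p < length (?e # c) \<and> snd ((?e # c) ! p)} = (if M then {0} else {}) \<union> Suc ` ?I"
    by (auto simp: image_iff less_Suc_eq_0_disj)
  then have "mu_list u (?e # c) = prod ?F (if M then {0} else {}) * prod ?F (Suc ` ?I)"
    unfolding mu_list_def by (simp only:) (rule prod.union_disjoint, auto)
  also have "prod ?F (Suc ` ?I) = mu_list (u \<circ> transpose a b) c"
    unfolding mu_list_def by (subst prod.reindex) (auto simp del: comp_apply simp: o_def intro!: prod.cong)
  also have "prod ?F (if M then {0} else {}) = (if M then weight a (u a) else 1)"
    using cover_weight_transpose[OF assms] by simp
  finally show ?thesis .
qed

lemma chain_weight_mu_list:
  assumes "weight_hom \<phi>" "bij u" "ascending u (map fst c)"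
  shows "chain_weight \<phi> u c = (- 1) ^ length (filter (\<lambda>e. \<not> snd e) c) / \<phi> (mu_list u c)"
  using assms(2,3)
proof (induction c arbitrary: u)
  case Nil
  then show ?case using assms(1) by (simp add: mu_list_def weight_hom_def)
next
  case (Cons e c)
  obtain a b M where e: "e = ((a, b), M)" by (metis prod.exhaust)
  have "chain_weight \<phi> (u \<circ> transpose a b) c
      = (- 1) ^ length (filter (\<lambda>e. \<not> snd e) c) / \<phi> (mu_list (u \<circ> transpose a b) c)"
    by (rule Cons.IH) (use Cons.prems in \<open>auto simp: e bij_comp simp del: comp_apply\<close>)
  then show ?case
    using Cons.prems assms(1) by (cases M) (simp_all add: e mu_list_Cons weight_hom_def del: comp_apply)
qed

lemma chain_weight_positions:
  assumes "\<And>i j. \<phi> (weight i j) = x i"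
  shows "chain_weight \<phi> u c = (- 1) ^ length (filter (\<lambda>e. \<not> snd e) c)
      / prod_list (map (\<lambda>e. x (fst (fst e))) (filter snd c))"
proof (induction c arbitrary: u)
  case (Cons e c)
  obtain a b M where e: "e = ((a, b), M)" by (metis prod.exhaust)
  show ?case using Cons.IH[of "u \<circ> transpose a b"] by (simp add: e assms del: comp_apply)
qed simp

lemma num_unmarked: "length (filter (\<lambda>e. \<not> snd e) (concat \<gamma>)) = num_covers \<gamma> - num_marked \<gamma>"
  using sum_length_filter_compl[of snd "concat \<gamma>"] by (simp add: num_covers_def num_marked_def)

lemma prod_marked_in:
  fixes x :: "nat \<Rightarrow> 'a::comm_monoid_mult"
  assumes "length \<gamma> = n - 1" "\<And>j e. j < n - 1 \<Longrightarrow> e \<in> set (\<gamma> ! j) \<Longrightarrow> fst (fst e) = Suc j"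
  shows "prod_list (map (\<lambda>e. x (fst (fst e))) (filter snd (concat \<gamma>)))
      = (\<Prod>k\<in>{1..<n}. x k ^ marked_in \<gamma> k)"
proof -
  let ?f = "\<lambda>c. prod_list (map (\<lambda>e. x (fst (fst e))) (filter snd c))"
  have "?f (concat \<gamma>) = prod_list (map ?f \<gamma>)"
    by (induction \<gamma>) auto
  also have "\<dots> = (\<Prod>j = 0..<n - 1. ?f (\<gamma> ! j))"
    by (simp add: prod.list_conv_set_nth assms(1))
  also have "\<dots> = (\<Prod>j = 0..<n - 1. x (Suc j) ^ marked_in \<gamma> (Suc j))"
  proof (intro prod.cong refl)
    fix j assume j: "j \<in> {0..<n - 1}"
    have "map (\<lambda>e. x (fst (fst e))) (filter snd (\<gamma> ! j)) = map (\<lambda>e. x (Suc j)) (filter snd (\<gamma> ! j))"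
      using assms(2)[of j] j by (intro map_cong refl) auto
    then show "?f (\<gamma> ! j) = x (Suc j) ^ marked_in \<gamma> (Suc j)"
      by (simp add: marked_in_def map_replicate_const)
  qed
  also have "\<dots> = (\<Prod>k\<in>{1..<n}. x k ^ marked_in \<gamma> k)"
    by (rule prod.reindex_bij_witness[of _ "\<lambda>k. k - 1" Suc]) auto
  finally show ?thesis .
qed

lemma ratfun_hom: "ratfun (f - g) = ratfun f - ratfun g" "ratfun (f * g) = ratfun f * ratfun g"
    "ratfun 1 = 1"
  "ratfun f = 0 \<longleftrightarrow> f = 0"
  by (simp_all add: ratfun_def One_fract_def Zero_fract_def eq_fract)

lemma ratfun_power: "ratfun (f ^ k) = ratfun f ^ k"
  by (induction k) (simp_all add: ratfun_hom)

lemma ratfun_prod: "ratfun (prod h A) = (\<Prod>a\<in>A. ratfun (h a))"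
  by (induction A rule: infinite_finite_induct) (simp_all add: ratfun_hom)

lemma set_y_0_Groth_longest: "set_y_0 (Groth_longest n) = (\<Prod>k\<in>{1..<n}. xvar k ^ (n - k))"
proof -
  have "set_y_0 (Groth_longest n) = (\<Prod>a\<in>{1..n}. xvar a ^ (n - a))"
    by (simp add: Groth_longest_row_product[OF order.refl] row_product_def set_y_0_hom set_y_0_weight)
  also have "\<dots> = (\<Prod>k\<in>{1..<n}. xvar k ^ (n - k))"
    by (rule prod.mono_neutral_right) auto
  finally show ?thesis .
qed

theorem corollary6p11:
  fixes n :: nat and w :: "nat \<Rightarrow> nat"
  assumes "w permutes {1..n}"
  shows "ratfun (double_Groth n w) =
      (\<Sum>\<gamma>\<in>climbing_marked_chains n w.
        (-1) ^ (num_covers \<gamma> - num_marked \<gamma>) * (ratfun (Groth_longest n) / ratfun (mu w \<gamma>)))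
    \<and> ratfun (Groth n w) =
      (\<Sum>\<gamma>\<in>climbing_marked_chains n w.
        (-1) ^ (num_covers \<gamma> - num_marked \<gamma>) *
        (ratfun (\<Prod>k\<in>{1..<n}. xvar k ^ (n - k)) / ratfun (\<Prod>k\<in>{1..<n}. xvar k ^ marked_in \<gamma> k)))"
proof
  have parts: "length \<gamma> = n - 1" "ascending w (map fst (concat \<gamma>))"
    "\<And>j e. j < n - 1 \<Longrightarrow> e \<in> set (\<gamma> ! j) \<Longrightarrow> fst (fst e) = Suc j"
    if "\<gamma> \<in> climbing_marked_chains n w" for \<gamma>
    using that partial_climb_structure[OF assms, of "n - 1" \<gamma>]
    unfolding climbing_marked_chains_eq[OF assms] by (cases n; auto simp: partial_climbs_def)+
  have hom: "weight_hom ratfun"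
    by (simp add: weight_hom_def ratfun_hom weight_nonzero)
  have "mu w \<gamma> = mu_list w (concat \<gamma>)" for \<gamma>
    by (simp add: mu_def mu_list_def perm_at_def)
  then have "chain_weight ratfun w (concat \<gamma>) * ratfun (Groth_longest n)
      = (-1) ^ (num_covers \<gamma> - num_marked \<gamma>) * (ratfun (Groth_longest n) / ratfun (mu w \<gamma>))"
    if "\<gamma> \<in> climbing_marked_chains n w" for \<gamma>
    using chain_weight_mu_list[OF hom permutes_bij[OF assms] parts(2)[OF that]]
    by (simp add: num_unmarked)
  then show "ratfun (double_Groth n w) =
      (\<Sum>\<gamma>\<in>climbing_marked_chains n w.
        (-1) ^ (num_covers \<gamma> - num_marked \<gamma>) * (ratfun (Groth_longest n) / ratfun (mu w \<gamma>)))"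
    unfolding climbing_sum[OF hom assms] by (intro sum.cong refl) blast
  let ?\<phi> = "\<lambda>f. ratfun (set_y_0 f)"
  have hom_y: "weight_hom ?\<phi>"
    by (simp add: weight_hom_def ratfun_hom set_y_0_hom set_y_0_weight xvar_nonzero)
  have "chain_weight ?\<phi> w (concat \<gamma>) * ?\<phi> (Groth_longest n)
      = (-1) ^ (num_covers \<gamma> - num_marked \<gamma>) *
        (ratfun (\<Prod>k\<in>{1..<n}. xvar k ^ (n - k)) / ratfun (\<Prod>k\<in>{1..<n}. xvar k ^ marked_in \<gamma> k))"
    if "\<gamma> \<in> climbing_marked_chains n w" for \<gamma>
    using prod_marked_in[OF parts(1,3)[OF that], of "\<lambda>k. ratfun (xvar k)"]
      chain_weight_positions[of ?\<phi> "\<lambda>k. ratfun (xvar k)" w "concat \<gamma>"]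
    by (simp add: num_unmarked set_y_0_weight set_y_0_Groth_longest ratfun_prod ratfun_power)
  then show "ratfun (Groth n w) =
      (\<Sum>\<gamma>\<in>climbing_marked_chains n w.
        (-1) ^ (num_covers \<gamma> - num_marked \<gamma>) *
        (ratfun (\<Prod>k\<in>{1..<n}. xvar k ^ (n - k)) / ratfun (\<Prod>k\<in>{1..<n}. xvar k ^ marked_in \<gamma> k)))"
    unfolding Groth_def climbing_sum[OF hom_y assms] by (intro sum.cong refl) blast
qed


end
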